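(* Let $(G,g)$ be a connected, simply connected three-dimensional Lie group with a left-invariant Lorentzian metric of Type III, i.e. its Lie algebra $\mathfrak{g}$ admits an orthonormal basis $\{e_1,e_2,e_3\}$ of signature $(++-)$ with $$[e_1,e_2]=-\tfrac{1}{\sqrt2}e_1-\alpha e_3,\quad [e_1,e_3]=-\tfrac{1}{\sqrt2}e_1-\alpha e_2,\quad [e_2,e_3]=\alpha e_1+\tfrac{1}{\sqrt2}(e_2-e_3)$$ for some $\alpha\in\mathbb{R}$. Then $(G,g)$ admits a non-trivial left-invariant Cotton soliton if and only if $\alpha\neq0$, and then $\mathfrak{g}$ is isomorphic to $\mathfrak{so}(1,2)\cong\mathfrak{sl}(2,\mathbb{R})$. Moreover, in such a case, the left-invariant Cotton soliton is steady ($\lambda=0$) and given by $$X=-\frac{3\alpha^2}{2}e_1+\frac{3\alpha}{\sqrt2}(e_2-e_3).$$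
   Context: Let $\nabla$ be the Levi-Civita connection of a three-dimensional pseudo-Riemannian manifold, $R(X,Y)=\nabla_{[X,Y]}-[\nabla_X,\nabla_Y]$, Ricci tensor $\rho(X,Y)=\operatorname{trace}\{Z\mapsto R(X,Z)Y\}$, scalar curvature $\tau$, Schouten tensor $S=\rho-\frac{\tau}{4}g$. The $(0,3)$-Cotton tensor is $C_{ijk}=(\nabla_iS)_{jk}-(\nabla_jS)_{ik}$, and the $(0,2)$-Cotton tensor is $C_{ij}=\frac{1}{2\sqrt{|\det g|}}C_{nmi}\,\epsilon^{nm\ell}g_{\ell j}$, where $\epsilon^{ijk}$ is the Levi-Civita symbol with $\epsilon^{123}=1$; here the orientation is the one for which $\{e_1,e_2,e_3\}$ is positively oriented. Signature $(++-)$ means $g(e_1,e_1)=g(e_2,e_2)=-g(e_3,e_3)=1$. A Cotton soliton is a vector field $X$ satisfying $\mathcal{L}_Xg+C=\lambda g$ for some $\lambda\in\mathbb{R}$; it is trivial if $C=0$, and steady if $\lambda=0$. Elements of $\mathfrak{g}$ are identified with left-invariant vector fields on $G$. *)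

theory Defs
  imports "HOL-Analysis.Analysis" "HOL-Algebra.Group"
begin

section \<open>Smooth three-manifolds\<close>

text \<open>
  \<open>Ck_on k S f\<close> is meant for an open set \<open>S\<close> of a finite-dimensional space, where iterating
  directional derivatives yields the usual class of \<open>k\<close> times continuously differentiable maps.
\<close>

primrec Ck_on :: "nat \<Rightarrow> 'a::euclidean_space set \<Rightarrow> ('a \<Rightarrow> 'b::real_normed_vector) \<Rightarrow> bool" where
  "Ck_on 0 S f \<longleftrightarrow> continuous_on S f"
| "Ck_on (Suc k) S f \<longleftrightarrow>
     (\<forall>x\<in>S. f differentiable (at x)) \<and> (\<forall>v. Ck_on k S (\<lambda>x. frechet_derivative f (at x) v))"

definition smooth_on :: "'a::euclidean_space set \<Rightarrow> ('a \<Rightarrow> 'b::real_normed_vector) \<Rightarrow> bool" where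
  "smooth_on S f \<longleftrightarrow> (\<forall>k. Ck_on k S f)"

text \<open>
  The manifold is a whole type \<open>'g\<close> with its topology; a chart is a domain together with
  a coordinate map (whose values outside the domain are irrelevant).
\<close>

type_synonym 'g atlas = "('g set \<times> ('g \<Rightarrow> real^3)) set"

definition smooth_atlas :: "'g::topological_space atlas \<Rightarrow> bool" where
  "smooth_atlas A \<longleftrightarrow>
     (\<forall>(U,\<phi>)\<in>A. open U \<and> open (\<phi> ` U) \<and> homeomorphism U (\<phi> ` U) \<phi> (inv_into U \<phi>)) \<and>
     (\<Union>(U,\<phi>)\<in>A. U) = UNIV \<and>
     (\<forall>(U,\<phi>)\<in>A. \<forall>(V,\<psi>)\<in>A. smooth_on (\<phi> ` (U \<inter> V)) (\<psi> \<circ> inv_into U \<phi>))"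

definition smooth_functions :: "'g atlas \<Rightarrow> ('g \<Rightarrow> real) set" where
  "smooth_functions A = {f. \<forall>(U,\<phi>)\<in>A. smooth_on (\<phi> ` U) (f \<circ> inv_into U \<phi>)}"

text \<open>
  Tangent vectors at \<open>p\<close> are the derivations at \<open>p\<close> of the algebra of smooth functions.
  They are extended by \<open>0\<close> to non-smooth functions, so that equality of tangent vectors
  (and of vector fields) is equality of HOL functions.
\<close>

type_synonym 'g tvec = "('g \<Rightarrow> real) \<Rightarrow> real"
type_synonym 'g vfield = "'g \<Rightarrow> 'g tvec"

definition tangent_space :: "'g atlas \<Rightarrow> 'g \<Rightarrow> 'g tvec set" where
  "tangent_space A p =
     {v. (\<forall>f. f \<notin> smooth_functions A \<longrightarrow> v f = 0) \<and>
         (\<forall>f\<in>smooth_functions A. \<forall>h\<in>smooth_functions A.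
            v (\<lambda>x. f x + h x) = v f + v h \<and>
            v (\<lambda>x. f x * h x) = f p * v h + h p * v f) \<and>
         (\<forall>c. \<forall>f\<in>smooth_functions A. v (\<lambda>x. c * f x) = c * v f)}"

definition tangent_basis :: "'g atlas \<Rightarrow> 'g \<Rightarrow> (3 \<Rightarrow> 'g tvec) \<Rightarrow> bool" where
  "tangent_basis A p b \<longleftrightarrow>
     (\<forall>i. b i \<in> tangent_space A p) \<and>
     (\<forall>v\<in>tangent_space A p. \<exists>!c::real^3. v = (\<lambda>f. \<Sum>i\<in>UNIV. c$i * b i f))"

definition vector_fields :: "'g atlas \<Rightarrow> 'g vfield set" where
  "vector_fields A =
     {X. (\<forall>p. X p \<in> tangent_space A p) \<and>
         (\<forall>f\<in>smooth_functions A. (\<lambda>p. X p f) \<in> smooth_functions A)}"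

definition vadd :: "'g vfield \<Rightarrow> 'g vfield \<Rightarrow> 'g vfield" where
  "vadd X Y = (\<lambda>p f. X p f + Y p f)"

definition vscale :: "('g \<Rightarrow> real) \<Rightarrow> 'g vfield \<Rightarrow> 'g vfield" where
  "vscale h X = (\<lambda>p f. h p * X p f)"

definition lie_bracket :: "'g vfield \<Rightarrow> 'g vfield \<Rightarrow> 'g vfield" where
  "lie_bracket X Y = (\<lambda>p f. X p (\<lambda>q. Y q f) - Y p (\<lambda>q. X q f))"

definition pushforward :: "'g atlas \<Rightarrow> ('g \<Rightarrow> 'g) \<Rightarrow> 'g tvec \<Rightarrow> 'g tvec" where
  "pushforward A F v = (\<lambda>f. if f \<in> smooth_functions A then v (f \<circ> F) else 0)"


section \<open>Pseudo-Riemannian geometry\<close>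

type_synonym 'g metric = "'g \<Rightarrow> 'g tvec \<Rightarrow> 'g tvec \<Rightarrow> real"
type_synonym 'g connection = "'g vfield \<Rightarrow> 'g vfield \<Rightarrow> 'g vfield"
type_synonym 'g tensor02 = "'g vfield \<Rightarrow> 'g vfield \<Rightarrow> 'g \<Rightarrow> real"

definition eta :: "3 \<Rightarrow> 3 \<Rightarrow> real" where
  "eta i j = (if i = j then (if i = 3 then -1 else 1) else 0)"

definition lorentzian_metric :: "'g atlas \<Rightarrow> 'g metric \<Rightarrow> bool" where
  "lorentzian_metric A g \<longleftrightarrow>
     (\<forall>p. \<forall>u\<in>tangent_space A p. \<forall>v\<in>tangent_space A p. \<forall>w\<in>tangent_space A p. \<forall>c.
        g p u v = g p v u \<and>
        g p (\<lambda>f. u f + v f) w = g p u w + g p v w \<and>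
        g p (\<lambda>f. c * u f) w = c * g p u w) \<and>
     (\<forall>p. \<exists>b. tangent_basis A p b \<and> (\<forall>i j. g p (b i) (b j) = eta i j)) \<and>
     (\<forall>X\<in>vector_fields A. \<forall>Y\<in>vector_fields A. (\<lambda>p. g p (X p) (Y p)) \<in> smooth_functions A)"

definition levi_civita :: "'g atlas \<Rightarrow> 'g metric \<Rightarrow> 'g connection \<Rightarrow> bool" where
  "levi_civita A g D \<longleftrightarrow>
     (\<forall>X\<in>vector_fields A. \<forall>Y\<in>vector_fields A.
        D X Y \<in> vector_fields A \<and>
        vadd (D X Y) (vscale (\<lambda>p. -1) (D Y X)) = lie_bracket X Y) \<and>
     (\<forall>X\<in>vector_fields A. \<forall>Y\<in>vector_fields A. \<forall>Z\<in>vector_fields A.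
        D (vadd X Y) Z = vadd (D X Z) (D Y Z) \<and>
        D X (vadd Y Z) = vadd (D X Y) (D X Z) \<and>
        (\<forall>p. X p (\<lambda>q. g q (Y q) (Z q)) = g p (D X Y p) (Z p) + g p (Y p) (D X Z p))) \<and>
     (\<forall>h\<in>smooth_functions A. \<forall>X\<in>vector_fields A. \<forall>Y\<in>vector_fields A.
        D (vscale h X) Y = vscale h (D X Y) \<and>
        D X (vscale h Y) = vadd (vscale (\<lambda>p. X p h) Y) (vscale h (D X Y)))"

text \<open>Sign convention: \<open>R(X,Y) = \<nabla>\<^bsub>[X,Y]\<^esub> - [\<nabla>\<^bsub>X\<^esub>, \<nabla>\<^bsub>Y\<^esub>]\<close>.\<close>

definition curvature :: "'g connection \<Rightarrow> 'g vfield \<Rightarrow> 'g vfield \<Rightarrow> 'g vfield \<Rightarrow> 'g vfield" where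
  "curvature D X Y Z = (\<lambda>p f. D (lie_bracket X Y) Z p f - (D X (D Y Z) p f - D Y (D X Z) p f))"

text \<open>
  Trace at \<open>p\<close> of an endomorphism \<open>T\<close> of the module of vector fields that is linear over the
  smooth functions, computed in any vector fields \<open>E\<close> forming a basis at \<open>p\<close>.
\<close>

definition trace_at :: "'g atlas \<Rightarrow> ('g vfield \<Rightarrow> 'g vfield) \<Rightarrow> 'g \<Rightarrow> real" where
  "trace_at A T p = (THE t. \<exists>E. \<exists>c::real^3^3.
     (\<forall>i. E i \<in> vector_fields A) \<and> tangent_basis A p (\<lambda>i. E i p) \<and>
     (\<forall>j. T (E j) p = (\<lambda>f. \<Sum>i\<in>UNIV. c$i$j * E i p f)) \<and> t = trace c)"

definition ricci :: "'g atlas \<Rightarrow> 'g connection \<Rightarrow> 'g tensor02" where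
  "ricci A D X Y = trace_at A (\<lambda>Z. curvature D X Z Y)"

definition ricci_operator :: "'g atlas \<Rightarrow> 'g metric \<Rightarrow> 'g connection \<Rightarrow> 'g vfield \<Rightarrow> 'g vfield" where
  "ricci_operator A g D X = (THE W. W \<in> vector_fields A \<and>
     (\<forall>Y\<in>vector_fields A. \<forall>p. g p (W p) (Y p) = ricci A D X Y p))"

definition scalar_curvature :: "'g atlas \<Rightarrow> 'g metric \<Rightarrow> 'g connection \<Rightarrow> 'g \<Rightarrow> real" where
  "scalar_curvature A g D = trace_at A (ricci_operator A g D)"

definition schouten :: "'g atlas \<Rightarrow> 'g metric \<Rightarrow> 'g connection \<Rightarrow> 'g tensor02" where
  "schouten A g D X Y = (\<lambda>p. ricci A D X Y p - scalar_curvature A g D p / 4 * g p (X p) (Y p))"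

definition cov_deriv02 :: "'g connection \<Rightarrow> 'g tensor02 \<Rightarrow> 'g vfield \<Rightarrow> 'g tensor02" where
  "cov_deriv02 D S Z X Y = (\<lambda>p. Z p (S X Y) - S (D Z X) Y p - S X (D Z Y) p)"

definition cotton03 ::
  "'g atlas \<Rightarrow> 'g metric \<Rightarrow> 'g connection \<Rightarrow> 'g vfield \<Rightarrow> 'g vfield \<Rightarrow> 'g vfield \<Rightarrow> 'g \<Rightarrow> real" where
  "cotton03 A g D X Y Z = (\<lambda>p. cov_deriv02 D (schouten A g D) X Y Z p
                              - cov_deriv02 D (schouten A g D) Y X Z p)"

definition levi_civita_symbol :: "3 \<Rightarrow> 3 \<Rightarrow> 3 \<Rightarrow> real" where
  "levi_civita_symbol i j k =
     (if (i, j, k) \<in> {(1, 2, 3), (2, 3, 1), (3, 1, 2)} then 1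
      else if (i, j, k) \<in> {(1, 3, 2), (3, 2, 1), (2, 1, 3)} then -1 else 0)"

text \<open>
  The components \<open>C\<^sub>i\<^sub>j\<close> are taken in a frame \<open>E\<close>; \<open>cotton02 A g D E (E i) (E j)\<close> is \<open>C\<^sub>i\<^sub>j\<close>, and the
  formula is linear over smooth functions in both arguments. Since
  \<open>\<epsilon> / sqrt \<bar>det g\<bar>\<close> is a tensor up to orientation, the result depends on \<open>E\<close> only through the
  orientation for which \<open>E\<close> is positively oriented.
\<close>

definition cotton02 ::
  "'g atlas \<Rightarrow> 'g metric \<Rightarrow> 'g connection \<Rightarrow> (3 \<Rightarrow> 'g vfield) \<Rightarrow> 'g tensor02" where
  "cotton02 A g D E X Y = (\<lambda>p.
     1 / (2 * sqrt \<bar>det (\<chi> i j. g p (E i p) (E j p))\<bar>) *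
     (\<Sum>n\<in>UNIV. \<Sum>m\<in>UNIV. \<Sum>l\<in>UNIV.
        cotton03 A g D (E n) (E m) X p * levi_civita_symbol n m l * g p (E l p) (Y p)))"

definition cotton_vanishes ::
  "'g atlas \<Rightarrow> 'g metric \<Rightarrow> 'g connection \<Rightarrow> (3 \<Rightarrow> 'g vfield) \<Rightarrow> bool" where
  "cotton_vanishes A g D E \<longleftrightarrow>
     (\<forall>Y\<in>vector_fields A. \<forall>Z\<in>vector_fields A. \<forall>p. cotton02 A g D E Y Z p = 0)"

definition lie_derivative_metric :: "'g metric \<Rightarrow> 'g vfield \<Rightarrow> 'g tensor02" where
  "lie_derivative_metric g X Y Z = (\<lambda>p. X p (\<lambda>q. g q (Y q) (Z q))
      - g p (lie_bracket X Y p) (Z p) - g p (Y p) (lie_bracket X Z p))"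

definition cotton_soliton ::
  "'g atlas \<Rightarrow> 'g metric \<Rightarrow> 'g connection \<Rightarrow> (3 \<Rightarrow> 'g vfield) \<Rightarrow> 'g vfield \<Rightarrow> real \<Rightarrow> bool" where
  "cotton_soliton A g D E X lam \<longleftrightarrow>
     X \<in> vector_fields A \<and>
     (\<forall>Y\<in>vector_fields A. \<forall>Z\<in>vector_fields A. \<forall>p.
        lie_derivative_metric g X Y Z p + cotton02 A g D E Y Z p = lam * g p (Y p) (Z p))"


section \<open>Lie groups and left-invariant structures\<close>

text \<open>Smoothness of a map includes its continuity, which makes the domains below open.\<close>

definition lie_group :: "'g::topological_space monoid \<Rightarrow> 'g atlas \<Rightarrow> bool" where
  "lie_group G A \<longleftrightarrow>
     smooth_atlas A \<and> group G \<and> carrier G = UNIV \<and>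
     continuous_on UNIV (\<lambda>(x,y). x \<otimes>\<^bsub>G\<^esub> y) \<and>
     (\<forall>(U,\<phi>)\<in>A. \<forall>(V,\<psi>)\<in>A. \<forall>(W,\<theta>)\<in>A.
        smooth_on {(x,y). x \<in> \<phi> ` U \<and> y \<in> \<psi> ` V \<and> inv_into U \<phi> x \<otimes>\<^bsub>G\<^esub> inv_into V \<psi> y \<in> W}
                  (\<lambda>(x,y). \<theta> (inv_into U \<phi> x \<otimes>\<^bsub>G\<^esub> inv_into V \<psi> y))) \<and>
     continuous_on UNIV (m_inv G) \<and>
     (\<forall>(U,\<phi>)\<in>A. \<forall>(V,\<psi>)\<in>A.
        smooth_on {x \<in> \<phi> ` U. m_inv G (inv_into U \<phi> x) \<in> V}
                  (\<lambda>x. \<psi> (m_inv G (inv_into U \<phi> x))))"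

definition lie_algebra :: "'g monoid \<Rightarrow> 'g atlas \<Rightarrow> 'g vfield set" where
  "lie_algebra G A =
     {X \<in> vector_fields A. \<forall>a p. X (a \<otimes>\<^bsub>G\<^esub> p) = pushforward A (\<lambda>q. a \<otimes>\<^bsub>G\<^esub> q) (X p)}"

definition left_invariant_metric :: "'g monoid \<Rightarrow> 'g atlas \<Rightarrow> 'g metric \<Rightarrow> bool" where
  "left_invariant_metric G A g \<longleftrightarrow>
     (\<forall>a p. \<forall>u\<in>tangent_space A p. \<forall>v\<in>tangent_space A p.
        g (a \<otimes>\<^bsub>G\<^esub> p) (pushforward A (\<lambda>q. a \<otimes>\<^bsub>G\<^esub> q) u) (pushforward A (\<lambda>q. a \<otimes>\<^bsub>G\<^esub> q) v) = g p u v)"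

definition lie_algebra_basis :: "'g monoid \<Rightarrow> 'g atlas \<Rightarrow> (3 \<Rightarrow> 'g vfield) \<Rightarrow> bool" where
  "lie_algebra_basis G A e \<longleftrightarrow>
     (\<forall>i. e i \<in> lie_algebra G A) \<and>
     (\<forall>X\<in>lie_algebra G A. \<exists>!c::real^3. X = (\<lambda>p f. \<Sum>i\<in>UNIV. c$i * e i p f))"

definition isomorphic_to_matrix_lie_algebra ::
  "'g monoid \<Rightarrow> 'g atlas \<Rightarrow> (real^'n^'n) set \<Rightarrow> bool" where
  "isomorphic_to_matrix_lie_algebra G A L \<longleftrightarrow> (\<exists>\<Phi>.
     bij_betw \<Phi> (lie_algebra G A) L \<and>
     (\<forall>X\<in>lie_algebra G A. \<forall>Y\<in>lie_algebra G A.
        \<Phi> (vadd X Y) = \<Phi> X + \<Phi> Y \<and>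
        \<Phi> (lie_bracket X Y) = \<Phi> X ** \<Phi> Y - \<Phi> Y ** \<Phi> X) \<and>
     (\<forall>c. \<forall>X\<in>lie_algebra G A. \<Phi> (vscale (\<lambda>p. c) X) = c *\<^sub>R \<Phi> X))"

definition sl2 :: "(real^2^2) set" where
  "sl2 = {M. trace M = 0}"

definition so12 :: "(real^3^3) set" where
  "so12 = (let J = (\<chi> i j. if i = j then (if i = 1 then 1 else -1) else 0)
           in {M. transpose M ** J + J ** M = 0})"

end

theory Submission
  imports Defs
begin

text \<open>
  The frame \<open>e\<close> is orthonormal and its brackets have constant coefficients, so every tensor built from
  the metric has constant components in it, and the soliton equation for a left-invariant field
  becomes finitely many polynomial equations between real numbers.

  Three facts make the reduction. First, three orthonormal tangent vectors span the tangent space,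
  because the metric is nondegenerate and some basis has three elements (\<open>frame_expansion\<close>); hence
  every vector field is a combination of the frame with smooth coefficients, and anything linear over
  the smooth functions is determined by its values on the frame (\<open>tensor_expand\<close>). Second, Koszul's
  formula yields the Levi-Civita connection on the frame from the structure constants
  (\<open>connection_frame\<close>). Third, the trace of a tensorial endomorphism is the same in all frames
  (\<open>trace_at_frame\<close>). Ricci, Schouten and Cotton tensors then follow by finite sums, and
  \<open>cotton_soliton_frame\<close> states the soliton equation in components.

  For type III, put \<open>s = 1 / sqrt 2\<close> and \<open>X = x\<^sub>1 e\<^sub>1 + x\<^sub>2 e\<^sub>2 + x\<^sub>3 e\<^sub>3\<close>. The Cotton tensor has
  \<open>C\<^sub>1\<^sub>1 = 0\<close>, \<open>C\<^sub>1\<^sub>2 = C\<^sub>1\<^sub>3 = 3 s \<alpha>\<^sup>2 / 2\<close> and \<open>C\<^sub>2\<^sub>2 = C\<^sub>2\<^sub>3 = C\<^sub>3\<^sub>3 = 6 s\<^sup>2 \<alpha>\<close>, so it vanishes exactly for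
  \<open>\<alpha> = 0\<close>. The soliton equations are
  \<open>-2s(x\<^sub>2 + x\<^sub>3) = \<lambda>\<close>, \<open>s x\<^sub>1 + 3 s \<alpha>\<^sup>2 / 2 = 0\<close>, \<open>2 s x\<^sub>3 + 6 s\<^sup>2 \<alpha> = \<lambda>\<close>, \<open>-2 s x\<^sub>2 + 6 s\<^sup>2 \<alpha> = -\<lambda>\<close>
  and \<open>s(x\<^sub>3 - x\<^sub>2) + 6 s\<^sup>2 \<alpha> = 0\<close>. Subtracting the fourth from the third gives
  \<open>2s(x\<^sub>2 + x\<^sub>3) = 2\<lambda>\<close>, which with the first forces \<open>\<lambda> = 0\<close>; the rest is then uniquely solvable.

  For the Lie algebra, \<open>[e\<^sub>1, e\<^sub>2 - e\<^sub>3] = \<alpha>(e\<^sub>2 - e\<^sub>3)\<close>. When \<open>\<alpha> \<noteq> 0\<close> one can therefore take \<open>e\<^sub>1\<close> as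
  \<open>(\<alpha>/2) H\<close> and \<open>e\<^sub>2 - e\<^sub>3\<close> as \<open>E\<close> in an \<open>sl\<^sub>2\<close>-triple, and the other two brackets then
  determine \<open>e\<^sub>3\<close>. The matrix algebras come with such triples (\<open>sl2_triple_sl2\<close>, \<open>sl2_triple_so12\<close>).
\<close>

section \<open>Smooth real functions\<close>

lemma has_derivative_cong_open:
  assumes "open S" "x \<in> S" "\<And>y. y \<in> S \<Longrightarrow> f y = h y"
  shows "(f has_derivative F) (at x) \<longleftrightarrow> (h has_derivative F) (at x)"
  using assms has_derivative_transform_within_open[of f F x UNIV S h]
    has_derivative_transform_within_open[of h F x UNIV S f] by auto

text \<open>
  Derivatives of sums and products are given by the usual formulas only on \<open>S\<close>, so the inductions
  over the order of differentiability below need \<open>Ck_on\<close> to ignore values outside \<open>S\<close>.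
\<close>
lemma Ck_on_cong:
  assumes "open S" "\<And>x. x \<in> S \<Longrightarrow> f x = h x" "Ck_on k S f"
  shows "Ck_on k S h"
  using assms(2,3)
proof (induction k arbitrary: f h)
  case 0
  then show ?case using continuous_on_cong by auto
next
  case (Suc k)
  have eq: "(f has_derivative F) (at x) \<longleftrightarrow> (h has_derivative F) (at x)" if "x \<in> S" for x F
    using has_derivative_cong_open[OF assms(1) that] Suc.prems(1) by blast
  have "h differentiable (at x)" if "x \<in> S" for x
    using Suc.prems(2) eq[OF that] that by (metis Ck_on.simps(2) differentiable_def)
  moreover have "frechet_derivative f (at x) = frechet_derivative h (at x)" if "x \<in> S" for x
    using eq[OF that] by (simp add: frechet_derivative_def)
  then have "Ck_on k S (\<lambda>x. frechet_derivative h (at x) v)" for v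
    using Suc.IH[of "\<lambda>x. frechet_derivative f (at x) v" "\<lambda>x. frechet_derivative h (at x) v"] Suc.prems(2) by simp
  ultimately show ?case by simp
qed

lemma Ck_on_const: "Ck_on k S (\<lambda>x. c)"
  by (induction k arbitrary: c) simp_all

lemma Ck_on_Suc_imp: "Ck_on (Suc k) S f \<Longrightarrow> Ck_on k S f"
proof (induction k arbitrary: f)
  case 0
  then show ?case
    by (auto intro!: differentiable_imp_continuous_on simp: differentiable_on_def differentiable_at_withinI)
next
  case (Suc k)
  then show ?case by (metis Ck_on.simps(2))
qed

lemma Ck_on_add:
  assumes "open S"
  shows "Ck_on k S f \<Longrightarrow> Ck_on k S h \<Longrightarrow> Ck_on k S (\<lambda>x. f x + h x)"
proof (induction k arbitrary: f h)
  case 0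
  then show ?case by (auto intro: continuous_on_add)
next
  case (Suc k)
  have d: "((\<lambda>x. f x + h x) has_derivative
      (\<lambda>v. frechet_derivative f (at x) v + frechet_derivative h (at x) v)) (at x)" if "x \<in> S" for x
    using Suc.prems that by (auto intro!: has_derivative_add simp: frechet_derivative_works[symmetric])
  have "Ck_on k S (\<lambda>x. frechet_derivative (\<lambda>x. f x + h x) (at x) v)" for v
  proof (rule Ck_on_cong[OF assms])
    show "Ck_on k S (\<lambda>x. frechet_derivative f (at x) v + frechet_derivative h (at x) v)"
      using Suc by simp
  qed (simp add: frechet_derivative_at[OF d, symmetric])
  then show ?case using d by (auto simp: differentiable_def)
qed

lemma Ck_on_mult:
  fixes f h :: "'a::euclidean_space \<Rightarrow> real"
  assumes "open S"
  shows "Ck_on k S f \<Longrightarrow> Ck_on k S h \<Longrightarrow> Ck_on k S (\<lambda>x. f x * h x)"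
proof (induction k arbitrary: f h)
  case 0
  then show ?case by (auto intro: continuous_on_mult)
next
  case (Suc k)
  have d: "((\<lambda>x. f x * h x) has_derivative
      (\<lambda>v. f x * frechet_derivative h (at x) v + frechet_derivative f (at x) v * h x)) (at x)"
    if "x \<in> S" for x
    using Suc.prems that by (auto intro!: has_derivative_mult simp: frechet_derivative_works[symmetric])
  have "Ck_on k S (\<lambda>x. frechet_derivative (\<lambda>x. f x * h x) (at x) v)" for v
  proof (rule Ck_on_cong[OF assms])
    show "Ck_on k S (\<lambda>x. f x * frechet_derivative h (at x) v + frechet_derivative f (at x) v * h x)"
      using Suc.prems Ck_on_Suc_imp[OF Suc.prems(1)] Ck_on_Suc_imp[OF Suc.prems(2)]
      by (intro Ck_on_add[OF assms] Suc.IH) (simp_all only: Ck_on.simps)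
  qed (simp add: frechet_derivative_at[OF d, symmetric])
  then show ?case using d by (auto simp: differentiable_def)
qed

section \<open>Tensor calculus on a Lorentzian three-manifold\<close>

lemma vadd_apply [simp]: "vadd X Y p f = X p f + Y p f"
  by (simp add: vadd_def)

lemma vscale_apply [simp]: "vscale h X p f = h p * X p f"
  by (simp add: vscale_def)

lemma eta_simps [simp]: "eta i i * eta i i = 1" "i \<noteq> j \<Longrightarrow> eta i j = 0"
  by (auto simp: eta_def)

lemma eta_diag_nonzero [simp]: "eta i i \<noteq> 0"
  by (simp add: eta_def)

lemma eta_diag_assoc [simp]: "eta i i * (eta i i * x) = x"
  by (auto simp: eta_def)

locale lorentzian_manifold =
  fixes A :: "'g::topological_space atlas"
    and g :: "'g metric"
    and D :: "'g connection"
  assumes atlas: "smooth_atlas A"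
    and metric: "lorentzian_metric A g"
    and connection: "levi_civita A g D"
begin

lemma smooth_const [simp]: "(\<lambda>x. c) \<in> smooth_functions A"
  by (auto simp: smooth_functions_def smooth_on_def comp_def Ck_on_const)

lemma smooth_add [simp]:
  assumes "f \<in> smooth_functions A" "h \<in> smooth_functions A"
  shows "(\<lambda>x. f x + h x) \<in> smooth_functions A"
  using assms atlas unfolding smooth_functions_def smooth_on_def comp_def smooth_atlas_def
  by (auto intro!: Ck_on_add)

lemma smooth_mult [simp]:
  assumes "f \<in> smooth_functions A" "h \<in> smooth_functions A"
  shows "(\<lambda>x. f x * h x) \<in> smooth_functions A"
  using assms atlas unfolding smooth_functions_def smooth_on_def comp_def smooth_atlas_def
  by (auto intro!: Ck_on_mult)

lemma smooth_minus [simp]: "f \<in> smooth_functions A \<Longrightarrow> (\<lambda>x. - f x) \<in> smooth_functions A"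
  using smooth_mult[OF smooth_const[of "-1"], of f] by simp

lemma smooth_sum [simp]:
  assumes "finite I" "\<And>i. i \<in> I \<Longrightarrow> F i \<in> smooth_functions A"
  shows "(\<lambda>x. \<Sum>i\<in>I. F i x) \<in> smooth_functions A"
  using assms by (induction I rule: finite_induct) auto

lemma tangent_add: "v \<in> tangent_space A p \<Longrightarrow> f \<in> smooth_functions A \<Longrightarrow> h \<in> smooth_functions A
    \<Longrightarrow> v (\<lambda>x. f x + h x) = v f + v h"
  by (simp add: tangent_space_def)

lemma tangent_mult: "v \<in> tangent_space A p \<Longrightarrow> f \<in> smooth_functions A \<Longrightarrow> h \<in> smooth_functions A
    \<Longrightarrow> v (\<lambda>x. f x * h x) = f p * v h + h p * v f"
  by (simp add: tangent_space_def)

lemma tangent_cmult: "v \<in> tangent_space A p \<Longrightarrow> f \<in> smooth_functions A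
    \<Longrightarrow> v (\<lambda>x. c * f x) = c * v f"
  by (simp add: tangent_space_def del: smooth_const)

text \<open>Differentiating \<open>1 = 1 * 1\<close> shows that a derivation kills \<open>1\<close>, hence all constants.\<close>
lemma tangent_const:
  assumes "v \<in> tangent_space A p"
  shows "v (\<lambda>x. c) = 0"
proof -
  have "v (\<lambda>x. 1 * 1) = 1 * v (\<lambda>x. 1) + 1 * v (\<lambda>x. 1)"
    using tangent_mult[OF assms, of "\<lambda>x. 1" "\<lambda>x. 1"] by simp
  then have "v (\<lambda>x. 1) = 0" by simp
  then show ?thesis using tangent_cmult[OF assms, of "\<lambda>x. 1" c] by simp
qed

lemma tangent_space_add:
  "u \<in> tangent_space A p \<Longrightarrow> v \<in> tangent_space A p \<Longrightarrow> (\<lambda>f. u f + v f) \<in> tangent_space A p"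
  by (auto simp: tangent_space_def algebra_simps simp del: smooth_const)

lemma tangent_space_scale:
  "u \<in> tangent_space A p \<Longrightarrow> (\<lambda>f. c * u f) \<in> tangent_space A p"
  by (auto simp: tangent_space_def algebra_simps simp del: smooth_const)

lemma tangent_space_zero: "(\<lambda>f. 0) \<in> tangent_space A p"
  by (auto simp: tangent_space_def)

lemma tangent_space_sum:
  assumes "finite I" "\<And>i. i \<in> I \<Longrightarrow> v i \<in> tangent_space A p"
  shows "(\<lambda>f. \<Sum>i\<in>I. c i * v i f) \<in> tangent_space A p"
  using assms
proof (induction I rule: finite_induct)
  case empty
  show ?case by (simp add: tangent_space_zero)
next
  case (insert i I)
  then show ?case
    using tangent_space_add[OF tangent_space_scale[of "v i" p "c i"], of "\<lambda>f. \<Sum>i\<in>I. c i * v i f"]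
    by simp
qed

lemma g_sym: "u \<in> tangent_space A p \<Longrightarrow> v \<in> tangent_space A p \<Longrightarrow> g p u v = g p v u"
  using metric unfolding lorentzian_metric_def by blast

lemma g_add: "u \<in> tangent_space A p \<Longrightarrow> v \<in> tangent_space A p \<Longrightarrow> w \<in> tangent_space A p
    \<Longrightarrow> g p (\<lambda>f. u f + v f) w = g p u w + g p v w"
  using metric unfolding lorentzian_metric_def by blast

lemma g_scale: "u \<in> tangent_space A p \<Longrightarrow> w \<in> tangent_space A p
    \<Longrightarrow> g p (\<lambda>f. c * u f) w = c * g p u w"
  using metric unfolding lorentzian_metric_def by blast

lemma g_add_right:
  assumes "u \<in> tangent_space A p" "v \<in> tangent_space A p" "w \<in> tangent_space A p"
  shows "g p w (\<lambda>f. u f + v f) = g p w u + g p w v"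
  using g_add[OF assms] g_sym[OF tangent_space_add[OF assms(1,2)] assms(3)]
    g_sym[OF assms(1,3)] g_sym[OF assms(2,3)] by simp

lemma g_scale_right:
  assumes "u \<in> tangent_space A p" "w \<in> tangent_space A p"
  shows "g p w (\<lambda>f. c * u f) = c * g p w u"
  using g_scale[OF assms] g_sym[OF tangent_space_scale[OF assms(1)] assms(2)]
    g_sym[OF assms] by simp

lemma g_sum:
  assumes "finite I" "\<And>i. i \<in> I \<Longrightarrow> v i \<in> tangent_space A p" "w \<in> tangent_space A p"
  shows "g p (\<lambda>f. \<Sum>i\<in>I. c i * v i f) w = (\<Sum>i\<in>I. c i * g p (v i) w)"
  using assms
proof (induction I rule: finite_induct)
  case empty
  then show ?case using g_scale[OF tangent_space_zero empty(2), of 0] by simp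
next
  case (insert i I)
  then show ?case by (simp add: g_add g_scale tangent_space_scale tangent_space_sum)
qed

lemma g_sum2:
  assumes "finite I" "\<And>i. i \<in> I \<Longrightarrow> v i \<in> tangent_space A p" "w \<in> tangent_space A p"
  shows "g p w (\<lambda>f. \<Sum>i\<in>I. c i * v i f) = (\<Sum>i\<in>I. c i * g p w (v i))"
  using g_sum[OF assms] g_sym[OF assms(3) tangent_space_sum[OF assms(1,2)]]
    g_sym[OF assms(3) assms(2)] by simp

lemma vector_field_tangent [simp]: "X \<in> vector_fields A \<Longrightarrow> X p \<in> tangent_space A p"
  by (simp add: vector_fields_def)

lemma vector_field_smooth [simp]:
  "X \<in> vector_fields A \<Longrightarrow> f \<in> smooth_functions A \<Longrightarrow> (\<lambda>p. X p f) \<in> smooth_functions A"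
  unfolding vector_fields_def by blast

lemma vadd_closed [simp]:
  "X \<in> vector_fields A \<Longrightarrow> Y \<in> vector_fields A \<Longrightarrow> vadd X Y \<in> vector_fields A"
  by (simp add: vector_fields_def tangent_space_add vadd_def
      del: vector_field_tangent vector_field_smooth)

lemma vscale_closed [simp]:
  "h \<in> smooth_functions A \<Longrightarrow> X \<in> vector_fields A \<Longrightarrow> vscale h X \<in> vector_fields A"
  by (simp add: vector_fields_def tangent_space_scale vscale_def
      del: vector_field_tangent vector_field_smooth)

lemma g_smooth [simp]: "X \<in> vector_fields A \<Longrightarrow> Y \<in> vector_fields A
    \<Longrightarrow> (\<lambda>p. g p (X p) (Y p)) \<in> smooth_functions A"
  using metric unfolding lorentzian_metric_def by blast

lemma D_closed [simp]:
  "X \<in> vector_fields A \<Longrightarrow> Y \<in> vector_fields A \<Longrightarrow> D X Y \<in> vector_fields A"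
  using connection unfolding levi_civita_def by blast

text \<open>
  Vanishing torsion expresses the bracket through the connection, whose linearity rules then give
  those of the bracket.
\<close>
lemma bracket_eq_D:
  assumes "X \<in> vector_fields A" "Y \<in> vector_fields A"
  shows "lie_bracket X Y = vadd (D X Y) (vscale (\<lambda>p. -1) (D Y X))"
  using connection assms unfolding levi_civita_def by metis

lemma lie_bracket_closed [simp]:
  "X \<in> vector_fields A \<Longrightarrow> Y \<in> vector_fields A \<Longrightarrow> lie_bracket X Y \<in> vector_fields A"
  by (simp add: bracket_eq_D)

lemma D_add_left: "X \<in> vector_fields A \<Longrightarrow> Y \<in> vector_fields A \<Longrightarrow> Z \<in> vector_fields A
    \<Longrightarrow> D (vadd X Y) Z = vadd (D X Z) (D Y Z)"
  using connection unfolding levi_civita_def by blast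

lemma D_add_right: "X \<in> vector_fields A \<Longrightarrow> Y \<in> vector_fields A \<Longrightarrow> Z \<in> vector_fields A
    \<Longrightarrow> D X (vadd Y Z) = vadd (D X Y) (D X Z)"
  using connection unfolding levi_civita_def by blast

lemma D_metric: "X \<in> vector_fields A \<Longrightarrow> Y \<in> vector_fields A \<Longrightarrow> Z \<in> vector_fields A
    \<Longrightarrow> X p (\<lambda>q. g q (Y q) (Z q)) = g p (D X Y p) (Z p) + g p (Y p) (D X Z p)"
  using connection unfolding levi_civita_def by blast

lemma D_scale_left: "h \<in> smooth_functions A \<Longrightarrow> X \<in> vector_fields A \<Longrightarrow> Y \<in> vector_fields A
    \<Longrightarrow> D (vscale h X) Y = vscale h (D X Y)"
  using connection unfolding levi_civita_def by blast

lemma D_scale_right: "h \<in> smooth_functions A \<Longrightarrow> X \<in> vector_fields A \<Longrightarrow> Y \<in> vector_fields A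
    \<Longrightarrow> D X (vscale h Y) = vadd (vscale (\<lambda>p. X p h) Y) (vscale h (D X Y))"
  using connection unfolding levi_civita_def by blast

lemmas D_rules = D_add_left D_add_right D_scale_left D_scale_right

lemma lie_bracket_swap: "lie_bracket X Y = vscale (\<lambda>p. -1) (lie_bracket Y X)"
  by (rule ext)+ (simp add: lie_bracket_def)

lemma lie_bracket_add_left:
  assumes "X \<in> vector_fields A" "Y \<in> vector_fields A" "Z \<in> vector_fields A"
  shows "lie_bracket (vadd X Y) Z = vadd (lie_bracket X Z) (lie_bracket Y Z)"
  using assms by (intro ext) (simp add: bracket_eq_D D_rules)

lemma lie_bracket_scale_left:
  assumes "h \<in> smooth_functions A" "X \<in> vector_fields A" "Y \<in> vector_fields A"
  shows "lie_bracket (vscale h X) Y = vadd (vscale h (lie_bracket X Y)) (vscale (\<lambda>p. - Y p h) X)"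
  using assms by (intro ext) (simp add: bracket_eq_D D_rules algebra_simps)

text \<open>
  One-forms as maps of vector fields. A vector-valued tensor \<open>T\<close> is covered by applying this to
  \<open>\<lambda>X p. T X p f\<close> for each function \<open>f\<close>.
\<close>
definition tensorial :: "('g vfield \<Rightarrow> 'g \<Rightarrow> real) \<Rightarrow> bool" where
  "tensorial T \<longleftrightarrow>
     (\<forall>X\<in>vector_fields A. \<forall>Y\<in>vector_fields A. \<forall>p. T (vadd X Y) p = T X p + T Y p) \<and>
     (\<forall>h\<in>smooth_functions A. \<forall>X\<in>vector_fields A. \<forall>p. T (vscale h X) p = h p * T X p)"

lemma tensorialI:
  assumes "\<And>X Y p. X \<in> vector_fields A \<Longrightarrow> Y \<in> vector_fields A \<Longrightarrow> T (vadd X Y) p = T X p + T Y p"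
    "\<And>h X p. h \<in> smooth_functions A \<Longrightarrow> X \<in> vector_fields A \<Longrightarrow> T (vscale h X) p = h p * T X p"
  shows "tensorial T"
  using assms by (auto simp: tensorial_def)

lemma tensorial_minus: "tensorial T \<Longrightarrow> tensorial (\<lambda>X p. - T X p)"
  by (simp add: tensorial_def)

lemma tensorial_D:
  "Y \<in> vector_fields A \<Longrightarrow> tensorial (\<lambda>X p. D X Y p f)"
  by (rule tensorialI) (simp_all add: D_rules)

lemma metric_vadd_vscale:
  assumes "X \<in> vector_fields A" "w \<in> tangent_space A p"
  shows "Y \<in> vector_fields A \<Longrightarrow> g p (vadd X Y p) w = g p (X p) w + g p (Y p) w"
    and "Y \<in> vector_fields A \<Longrightarrow> g p w (vadd X Y p) = g p w (X p) + g p w (Y p)"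
    and "g p (vscale h X p) w = h p * g p (X p) w"
    and "g p w (vscale h X p) = h p * g p w (X p)"
  using assms by (simp_all add: vadd_def vscale_def g_add g_scale g_add_right g_scale_right)

lemma tensorial_metric_left:
  "Y \<in> vector_fields A \<Longrightarrow> tensorial (\<lambda>X p. g p (X p) (Y p))"
  by (rule tensorialI) (simp_all add: metric_vadd_vscale)

lemma tensorial_metric_right:
  "X \<in> vector_fields A \<Longrightarrow> tensorial (\<lambda>Y p. g p (X p) (Y p))"
  by (rule tensorialI) (simp_all add: metric_vadd_vscale)

text \<open>
  For the last argument the terms with second derivatives of \<open>h\<close> add up to
  \<open>[X,Y]h - X(Y h) + Y(X h) = 0\<close>.
\<close>
lemma tensorial_curvature3:
  assumes "X \<in> vector_fields A" "Y \<in> vector_fields A"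
  shows "tensorial (\<lambda>Z p. curvature D X Y Z p f)"
proof (rule tensorialI)
  fix h Z p
  assume "h \<in> smooth_functions A" "Z \<in> vector_fields A"
  moreover have "lie_bracket X Y p h * Z p f = X p (\<lambda>q. Y q h) * Z p f - Y p (\<lambda>q. X q h) * Z p f"
    by (simp add: lie_bracket_def algebra_simps)
  ultimately show "curvature D X Y (vscale h Z) p f = h p * curvature D X Y Z p f"
    using assms by (simp add: curvature_def D_rules algebra_simps)
qed (use assms in \<open>simp add: curvature_def D_rules\<close>)

text \<open>
  The summand \<open>-(Y h) X\<close> of \<open>[h X, Y]\<close> contributes \<open>-(Y h) \<nabla>\<^sub>X Z\<close>, which cancels the derivative term of
  \<open>\<nabla>\<^sub>Y (h \<nabla>\<^sub>X Z)\<close>.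
\<close>
lemma tensorial_curvature1:
  assumes "Y \<in> vector_fields A" "Z \<in> vector_fields A"
  shows "tensorial (\<lambda>X p. curvature D X Y Z p f)"
  using assms
  by (intro tensorialI)
    (simp_all add: curvature_def D_rules lie_bracket_add_left lie_bracket_scale_left algebra_simps)

lemma curvature_swap:
  assumes "X \<in> vector_fields A" "Y \<in> vector_fields A" "Z \<in> vector_fields A"
  shows "curvature D X Y Z p f = - curvature D Y X Z p f"
  using assms lie_bracket_swap[of X Y] by (simp add: curvature_def D_rules)

lemma tensorial_curvature2:
  assumes "X \<in> vector_fields A" "Z \<in> vector_fields A"
  shows "tensorial (\<lambda>Y p. curvature D X Y Z p f)"
proof -
  have "tensorial (\<lambda>Y p. - curvature D Y X Z p f)"
    by (intro tensorial_minus tensorial_curvature1 assms)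
  then show ?thesis
    using assms curvature_swap[OF assms(1) _ assms(2)] by (simp add: tensorial_def)
qed

end

section \<open>Component formulas for constant structure functions\<close>

text \<open>
  Throughout, \<open>c i j k\<close> is the \<open>k\<close>-th coefficient of \<open>[e\<^sub>i, e\<^sub>j]\<close> in an orthonormal frame of signature
  \<open>(++-)\<close>. The connection coefficients are those of Koszul's formula, and in \<open>connection_coeff\<close> and
  \<open>curvature_coeff\<close> the last index is the upper one.
\<close>

definition connection_coeff :: "(3 \<Rightarrow> 3 \<Rightarrow> 3 \<Rightarrow> real) \<Rightarrow> 3 \<Rightarrow> 3 \<Rightarrow> 3 \<Rightarrow> real" where
  "connection_coeff c i j k = eta k k / 2 *
     (c i j k * eta k k - c j k i * eta i i + c k i j * eta j j)"

definition curvature_coeff :: "(3 \<Rightarrow> 3 \<Rightarrow> 3 \<Rightarrow> real) \<Rightarrow> 3 \<Rightarrow> 3 \<Rightarrow> 3 \<Rightarrow> 3 \<Rightarrow> real" where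
  "curvature_coeff c i j k m =
     (\<Sum>l\<in>UNIV. c i j l * connection_coeff c l k m
        - (connection_coeff c j k l * connection_coeff c i l m
           - connection_coeff c i k l * connection_coeff c j l m))"

definition ricci_coeff :: "(3 \<Rightarrow> 3 \<Rightarrow> 3 \<Rightarrow> real) \<Rightarrow> 3 \<Rightarrow> 3 \<Rightarrow> real" where
  "ricci_coeff c i k = (\<Sum>j\<in>UNIV. curvature_coeff c i j k j)"

definition scalar_coeff :: "(3 \<Rightarrow> 3 \<Rightarrow> 3 \<Rightarrow> real) \<Rightarrow> real" where
  "scalar_coeff c = (\<Sum>i\<in>UNIV. ricci_coeff c i i * eta i i)"

definition schouten_coeff :: "(3 \<Rightarrow> 3 \<Rightarrow> 3 \<Rightarrow> real) \<Rightarrow> 3 \<Rightarrow> 3 \<Rightarrow> real" where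
  "schouten_coeff c i j = ricci_coeff c i j - scalar_coeff c / 4 * eta i j"

definition schouten_deriv_coeff :: "(3 \<Rightarrow> 3 \<Rightarrow> 3 \<Rightarrow> real) \<Rightarrow> 3 \<Rightarrow> 3 \<Rightarrow> 3 \<Rightarrow> real" where
  "schouten_deriv_coeff c n i j =
     - (\<Sum>l\<in>UNIV. connection_coeff c n i l * schouten_coeff c l j)
     - (\<Sum>l\<in>UNIV. connection_coeff c n j l * schouten_coeff c i l)"

definition cotton03_coeff :: "(3 \<Rightarrow> 3 \<Rightarrow> 3 \<Rightarrow> real) \<Rightarrow> 3 \<Rightarrow> 3 \<Rightarrow> 3 \<Rightarrow> real" where
  "cotton03_coeff c n m i = schouten_deriv_coeff c n m i - schouten_deriv_coeff c m n i"

definition cotton02_coeff :: "(3 \<Rightarrow> 3 \<Rightarrow> 3 \<Rightarrow> real) \<Rightarrow> 3 \<Rightarrow> 3 \<Rightarrow> real" where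
  "cotton02_coeff c i j = 1 / 2 * (\<Sum>n\<in>UNIV. \<Sum>m\<in>UNIV. \<Sum>l\<in>UNIV.
     cotton03_coeff c n m i * levi_civita_symbol n m l * eta l j)"

definition lie_metric_coeff :: "(3 \<Rightarrow> 3 \<Rightarrow> 3 \<Rightarrow> real) \<Rightarrow> (3 \<Rightarrow> real) \<Rightarrow> 3 \<Rightarrow> 3 \<Rightarrow> real" where
  "lie_metric_coeff c x i j = (\<Sum>k\<in>UNIV. x k *
     (connection_coeff c i k j * eta j j + connection_coeff c j k i * eta i i))"

section \<open>Orthonormal frames\<close>

lemma sum_delta_eta [simp]:
  "(\<Sum>i\<in>UNIV. f i * eta i j) = f j * eta j j" "(\<Sum>i\<in>UNIV. f i * eta j i) = f j * eta j j"
proof -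
  have "(\<Sum>i\<in>UNIV. f i * eta i j) = (\<Sum>i\<in>UNIV. if i = j then f i * eta i i else 0)"
    by (rule sum.cong) auto
  also have "\<dots> = f j * eta j j" by simp
  finally show "(\<Sum>i\<in>UNIV. f i * eta i j) = f j * eta j j" .
  have "(\<Sum>i\<in>UNIV. f i * eta j i) = (\<Sum>i\<in>UNIV. if i = j then f i * eta i i else 0)"
    by (rule sum.cong) auto
  also have "\<dots> = f j * eta j j" by simp
  finally show "(\<Sum>i\<in>UNIV. f i * eta j i) = f j * eta j j" .
qed

lemma sum_delta_eta_left [simp]:
  "(\<Sum>i\<in>UNIV. eta i j * f i) = eta j j * f j" "(\<Sum>i\<in>UNIV. eta j i * f i) = eta j j * f j"
  using sum_delta_eta[of f j] by (simp_all only: mult.commute)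

text \<open>
  The model case is a left-invariant orthonormal frame of a Lie group, where left invariance makes the
  coefficients constant.
\<close>
locale constant_frame = lorentzian_manifold A g D
  for A :: "'g::topological_space atlas" and g D +
  fixes e :: "3 \<Rightarrow> 'g vfield" and c :: "3 \<Rightarrow> 3 \<Rightarrow> 3 \<Rightarrow> real"
  assumes frame_field [simp]: "e i \<in> vector_fields A"
    and orthonormal [simp]: "g p (e i p) (e j p) = eta i j"
    and bracket_frame: "lie_bracket (e i) (e j) = (\<lambda>p f. \<Sum>k\<in>UNIV. c i j k * e k p f)"
begin

lemma frame_coefficient:
  "g p (\<lambda>f. \<Sum>i\<in>UNIV. x i * e i p f) (e j p) = x j * eta j j"
  by (simp add: g_sum)

text \<open>
  Orthonormality alone does not give spanning; the dimension has to come from the basis \<open>b\<close> that the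
  metric provides. If the rows of \<open>M\<close> express \<open>e\<close> in \<open>b\<close>, then \<open>M N M\<^sup>T = N\<close> with \<open>N = diag (1,1,-1)\<close>, so
  \<open>M\<close> is invertible, and a vector orthogonal to all \<open>e\<^sub>i\<close> is zero. This is applied to the difference of
  the two sides.
\<close>
lemma frame_expansion:
  assumes v: "v \<in> tangent_space A p"
  shows "v = (\<lambda>f. \<Sum>i\<in>UNIV. (eta i i * g p v (e i p)) * e i p f)"
proof -
  obtain b where b: "tangent_basis A p b" and ortho: "\<And>i j. g p (b i) (b j) = eta i j"
    using metric unfolding lorentzian_metric_def by blast
  have bT: "b i \<in> tangent_space A p" for i
    using b by (simp add: tangent_basis_def)
  have coords: "\<exists>x::real^3. u = (\<lambda>f. \<Sum>i\<in>UNIV. x$i * b i f)" if "u \<in> tangent_space A p" for u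
    using b that unfolding tangent_basis_def by blast
  have "\<forall>i. \<exists>x::real^3. e i p = (\<lambda>f. \<Sum>k\<in>UNIV. x$k * b k f)"
    using coords by simp
  then obtain m :: "3 \<Rightarrow> real^3" where m: "\<And>i. e i p = (\<lambda>f. \<Sum>k\<in>UNIV. m i $ k * b k f)"
    by metis
  define M :: "real^3^3" where "M = (\<chi> i. m i)"
  define N :: "real^3^3" where "N = (\<chi> i j. eta i j)"
  have g_b: "g p (\<lambda>f. \<Sum>k\<in>UNIV. x$k * b k f) (e i p) = (M *v (N *v x)) $ i" for x :: "real^3" and i
  proof -
    have "g p (\<lambda>f. \<Sum>k\<in>UNIV. x$k * b k f) (e i p)
        = (\<Sum>k\<in>UNIV. x$k * (m i $ k * eta k k))"
      by (simp add: m g_sum g_sum2 bT tangent_space_sum ortho)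
    then show ?thesis
      by (simp add: M_def N_def matrix_vector_mult_def mult_ac)
  qed
  have NN: "N ** N = mat 1"
    by (simp add: N_def matrix_matrix_mult_def mat_def vec_eq_iff)
  have "M ** (N ** transpose M) = N"
  proof -
    have "(M ** (N ** transpose M)) $ i $ j = N $ i $ j" for i j
    proof -
      have "(M ** (N ** transpose M)) $ i $ j = (M *v (N *v m j)) $ i"
        by (simp add: matrix_vector_mult_def matrix_matrix_mult_def transpose_def M_def)
      also have "\<dots> = eta j i"
        using g_b[of "m j" i] orthonormal[of p j i] unfolding m[of j, symmetric] by (rule trans[OF sym])
      also have "\<dots> = N $ i $ j"
        by (simp add: N_def eta_def)
      finally show ?thesis .
    qed
    then show ?thesis by (simp add: vec_eq_iff)
  qed
  then have "M ** (N ** transpose M ** N) = mat 1"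
    using NN by (metis matrix_mul_assoc)
  then have left: "(N ** transpose M ** N) ** M = mat 1"
    using matrix_left_right_inverse by blast
  define w where "w = (\<lambda>f. v f - (\<Sum>i\<in>UNIV. (eta i i * g p v (e i p)) * e i p f))"
  have w_alt: "w = (\<lambda>f. v f + (\<Sum>i\<in>UNIV. - (eta i i * g p v (e i p)) * e i p f))"
    by (simp add: w_def sum_negf)
  have T: "(\<lambda>f. \<Sum>i\<in>UNIV. x i * e i p f) \<in> tangent_space A p" for x
    by (rule tangent_space_sum) auto
  have wT: "w \<in> tangent_space A p"
    unfolding w_alt by (rule tangent_space_add[OF v T])
  obtain d :: "real^3" where d: "w = (\<lambda>f. \<Sum>k\<in>UNIV. d$k * b k f)"
    using coords[OF wT] by (rule exE)
  have "g p w (e i p) = 0" for i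
  proof -
    have "g p w (e i p) = g p v (e i p)
        + g p (\<lambda>f. \<Sum>i\<in>UNIV. - (eta i i * g p v (e i p)) * e i p f) (e i p)"
      unfolding w_alt by (rule g_add[OF v T vector_field_tangent[OF frame_field]])
    then show ?thesis
      unfolding frame_coefficient by (simp add: mult.commute)
  qed
  then have "M *v (N *v d) = 0"
    by (simp add: vec_eq_iff flip: g_b d)
  then have "N *v d = 0"
    using left by (metis matrix_vector_mul_assoc matrix_vector_mul_lid matrix_vector_mult_0_right)
  then have "d = 0"
    using NN by (metis matrix_vector_mul_assoc matrix_vector_mul_lid matrix_vector_mult_0_right)
  then show ?thesis
    using d by (auto simp: w_def fun_eq_iff)
qed

definition coord :: "'g vfield \<Rightarrow> 3 \<Rightarrow> 'g \<Rightarrow> real" where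
  "coord X i p = eta i i * g p (X p) (e i p)"

definition frame_comb :: "(3 \<Rightarrow> 'g \<Rightarrow> real) \<Rightarrow> 'g vfield" where
  "frame_comb x = (\<lambda>p f. \<Sum>i\<in>UNIV. x i p * e i p f)"

lemma frame_comb_altdef:
  "frame_comb x = vadd (vadd (vscale (x 1) (e 1)) (vscale (x 2) (e 2))) (vscale (x 3) (e 3))"
  by (intro ext) (simp add: frame_comb_def sum_3)

lemma frame_comb_closed [simp]:
  "(\<And>i. x i \<in> smooth_functions A) \<Longrightarrow> frame_comb x \<in> vector_fields A"
  by (simp add: frame_comb_altdef)

lemma coord_frame_comb [simp]: "coord (frame_comb x) i p = x i p"
  by (simp add: coord_def frame_comb_def frame_coefficient mult.commute)

lemma coord_smooth [simp]: "X \<in> vector_fields A \<Longrightarrow> coord X i \<in> smooth_functions A"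
proof -
  assume "X \<in> vector_fields A"
  then have "(\<lambda>p. eta i i * g p (X p) (e i p)) \<in> smooth_functions A"
    by (intro smooth_mult smooth_const g_smooth frame_field)
  then show ?thesis by (simp add: coord_def[abs_def])
qed

lemma frame_comb_coord: "X \<in> vector_fields A \<Longrightarrow> frame_comb (coord X) = X"
  using frame_expansion[of "X p" p for p] by (auto simp: frame_comb_def coord_def)

lemma coord_frame [simp]: "coord (e i) j p = (if i = j then 1 else 0)"
  by (auto simp: coord_def)

lemma coord_vadd [simp]: "X \<in> vector_fields A \<Longrightarrow> Y \<in> vector_fields A
    \<Longrightarrow> coord (vadd X Y) i p = coord X i p + coord Y i p"
  by (simp add: coord_def vadd_def g_add algebra_simps)

lemma coord_vscale [simp]: "X \<in> vector_fields A \<Longrightarrow> coord (vscale h X) i p = h p * coord X i p"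
  by (simp add: coord_def vscale_def g_scale)

lemma tensor_expand:
  assumes T: "tensorial T" and X: "X \<in> vector_fields A"
  shows "T X p = (\<Sum>i\<in>UNIV. coord X i p * T (e i) p)"
proof -
  have "T (frame_comb (coord X)) p = (\<Sum>i\<in>UNIV. coord X i p * T (e i) p)"
    using T X by (simp add: frame_comb_altdef tensorial_def sum_3)
  then show ?thesis using X by (simp add: frame_comb_coord)
qed

lemma tensor_expand2:
  assumes "\<And>Y. Y \<in> vector_fields A \<Longrightarrow> tensorial (\<lambda>X. T X Y)"
    and "\<And>X. X \<in> vector_fields A \<Longrightarrow> tensorial (T X)"
    and "X \<in> vector_fields A" "Y \<in> vector_fields A"
  shows "T X Y p = (\<Sum>i\<in>UNIV. \<Sum>j\<in>UNIV. coord X i p * coord Y j p * T (e i) (e j) p)"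
  using tensor_expand[OF assms(1)[OF assms(4)] assms(3)] tensor_expand[OF assms(2) assms(4), of "e i" for i]
  by (simp add: sum_distrib_left mult.assoc)

text \<open>The common shape of the metric, Ricci, Schouten and Cotton tensors: constant frame components \<open>b\<close>.\<close>
definition bilinear_form :: "(3 \<Rightarrow> 3 \<Rightarrow> real) \<Rightarrow> 'g tensor02" where
  "bilinear_form b X Y p = (\<Sum>i\<in>UNIV. \<Sum>j\<in>UNIV. coord X i p * coord Y j p * b i j)"

lemma bilinear_form_frame [simp]: "bilinear_form b (e i) (e j) p = b i j"
proof -
  have "bilinear_form b (e i) (e j) p = (\<Sum>k\<in>UNIV. \<Sum>l\<in>UNIV. if j = l then (if i = k then b i j else 0) else 0)"
    unfolding bilinear_form_def by (intro sum.cong) auto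
  then show ?thesis by simp
qed

lemma tensorial_bilinear_form:
  "tensorial (\<lambda>X. bilinear_form b X Y)" "tensorial (bilinear_form b X)"
  by (auto intro!: tensorialI simp: bilinear_form_def sum_3 algebra_simps)

lemma bilinear_form_smooth [simp]:
  assumes "X \<in> vector_fields A" "Y \<in> vector_fields A"
  shows "bilinear_form b X Y \<in> smooth_functions A"
proof -
  have "(\<lambda>p. \<Sum>i\<in>UNIV. \<Sum>j\<in>UNIV. coord X i p * coord Y j p * b i j) \<in> smooth_functions A"
    using assms by (intro smooth_sum smooth_mult smooth_const) auto
  then show ?thesis by (simp add: bilinear_form_def[abs_def])
qed

lemma bilinear_formI:
  assumes "\<And>Y. Y \<in> vector_fields A \<Longrightarrow> tensorial (\<lambda>X. T X Y)"
    and "\<And>X. X \<in> vector_fields A \<Longrightarrow> tensorial (T X)"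
    and "\<And>i j p. T (e i) (e j) p = b i j"
    and "X \<in> vector_fields A" "Y \<in> vector_fields A"
  shows "T X Y p = bilinear_form b X Y p"
  using tensor_expand2[OF assms(1,2,4,5)] by (simp add: bilinear_form_def assms(3))

lemma metric_bilinear_form:
  assumes "X \<in> vector_fields A" "Y \<in> vector_fields A"
  shows "g p (X p) (Y p) = bilinear_form eta X Y p"
  by (rule bilinear_formI[OF tensorial_metric_left tensorial_metric_right _ assms]) auto

lemma connection_frame: "D (e i) (e j) = frame_comb (\<lambda>k p. connection_coeff c i j k)"
proof -
  have metric0: "g p (D (e i) (e j) p) (e k p) + g p (D (e i) (e k) p) (e j p) = 0" for i j k p
    using D_metric[of "e i" "e j" "e k" p] tangent_const[of "e i p" p]
      g_sym[of "e j p" p "D (e i) (e k) p"] by simp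
  have torsion: "g p (D (e i) (e j) p) (e k p) - g p (D (e j) (e i) p) (e k p) = c i j k * eta k k" for i j k p
  proof -
    have "coord (lie_bracket (e i) (e j)) k p = coord (D (e i) (e j)) k p - coord (D (e j) (e i)) k p"
      by (simp add: bracket_eq_D)
    moreover have "coord (lie_bracket (e i) (e j)) k p = c i j k"
      using coord_frame_comb[of "\<lambda>k p. c i j k"] by (simp add: bracket_frame frame_comb_def)
    ultimately have "eta k k * c i j k
        = eta k k * (eta k k * g p (D (e i) (e j) p) (e k p) - eta k k * g p (D (e j) (e i) p) (e k p))"
      by (simp add: coord_def)
    then show ?thesis by (simp add: right_diff_distrib mult.commute)
  qed
  have "coord (D (e i) (e j)) k = (\<lambda>p. connection_coeff c i j k)" for k
  proof
    fix p
    \<comment> \<open>Koszul: in the alternating sum of three torsion identities the metric identities cancel everything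
      but twice the wanted term.\<close>
    have "2 * g p (D (e i) (e j) p) (e k p) = c i j k * eta k k - c j k i * eta i i + c k i j * eta j j"
      using metric0[of p i j k] metric0[of p j k i] metric0[of p k i j]
        torsion[of p i j k] torsion[of p j k i] torsion[of p k i j]
      by linarith
    then show "coord (D (e i) (e j)) k p = connection_coeff c i j k"
      unfolding coord_def connection_coeff_def by (metis times_divide_eq_left times_divide_eq_right
          nonzero_mult_div_cancel_left zero_neq_numeral)
  qed
  then show ?thesis
    using frame_comb_coord[of "D (e i) (e j)"] by (metis D_closed frame_field ext)
qed

text \<open>
  A connection is not tensorial in its second argument, but the derivative terms vanish when the
  coefficients are constant.
\<close>
lemma D_const_comb:
  assumes "X \<in> vector_fields A"
  shows "D X (frame_comb (\<lambda>l p. v l)) p f = (\<Sum>l\<in>UNIV. v l * D X (e l) p f)"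
  using assms tangent_const[of "X p" p] by (simp add: frame_comb_altdef D_rules sum_3)

lemma curvature_frame:
  "curvature D (e i) (e j) (e k) p f = (\<Sum>m\<in>UNIV. curvature_coeff c i j k m * e m p f)"
proof -
  have 1: "D (e i) (D (e j) (e k)) p f
      = (\<Sum>m\<in>UNIV. (\<Sum>l\<in>UNIV. connection_coeff c j k l * connection_coeff c i l m) * e m p f)" for i j
    unfolding connection_frame[of j k] D_const_comb[OF frame_field]
    by (simp add: connection_frame frame_comb_def sum_3 algebra_simps)
  have 2: "D (lie_bracket (e i) (e j)) (e k) p f
      = (\<Sum>m\<in>UNIV. (\<Sum>l\<in>UNIV. c i j l * connection_coeff c l k m) * e m p f)"
  proof -
    have "lie_bracket (e i) (e j) = frame_comb (\<lambda>l p. c i j l)"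
      by (simp add: bracket_frame frame_comb_def)
    moreover have "D (frame_comb (\<lambda>l p. c i j l)) (e k) p f = (\<Sum>l\<in>UNIV. c i j l * D (e l) (e k) p f)"
      using tensor_expand[OF tensorial_D] by simp
    ultimately show ?thesis
      by (simp add: connection_frame frame_comb_def sum_3 algebra_simps)
  qed
  show ?thesis
    unfolding curvature_def 1 2 curvature_coeff_def
    by (simp add: sum_subtractf sum.distrib left_diff_distrib)
qed

lemma curvature_expand:
  assumes "X \<in> vector_fields A" "Y \<in> vector_fields A"
  shows "curvature D X (e j) Y p f =
    (\<Sum>m\<in>UNIV. bilinear_form (\<lambda>a b. curvature_coeff c a j b m) X Y p * e m p f)"
proof -
  have "curvature D X (e j) Y p f
      = (\<Sum>a\<in>UNIV. \<Sum>b\<in>UNIV. coord X a p * coord Y b p * curvature D (e a) (e j) (e b) p f)"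
    by (rule tensor_expand2[where T = "\<lambda>X Y p. curvature D X (e j) Y p f"])
      (use assms in \<open>auto intro: tensorial_curvature1 tensorial_curvature3\<close>)
  then show ?thesis
    by (simp add: curvature_frame bilinear_form_def sum_3 algebra_simps)
qed

end

context constant_frame
begin

section \<open>Ricci, Schouten and Cotton tensors in the frame\<close>

lemma frame_coefficients_unique:
  assumes "\<And>f. (\<Sum>i\<in>UNIV. x i * e i p f) = (\<Sum>i\<in>UNIV. y i * e i p f)"
  shows "x i = y i"
proof -
  have "x i * eta i i = y i * eta i i"
    using frame_coefficient[where x = x and p = p and j = i] frame_coefficient[where x = y and p = p and j = i]
    by (simp only: assms)
  then show ?thesis by simp
qed

lemma frame_tangent_basis: "tangent_basis A p (\<lambda>i. e i p)"
  unfolding tangent_basis_def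
proof (intro conjI ballI allI)
  fix v assume v: "v \<in> tangent_space A p"
  show "\<exists>!x::real^3. v = (\<lambda>f. \<Sum>i\<in>UNIV. x$i * e i p f)"
  proof
    show "v = (\<lambda>f. \<Sum>i\<in>UNIV. (\<chi> i. eta i i * g p v (e i p))$i * e i p f)"
      using frame_expansion[OF v] by simp
  next
    fix x :: "real^3" assume "v = (\<lambda>f. \<Sum>i\<in>UNIV. x$i * e i p f)"
    then have "(\<Sum>i\<in>UNIV. x$i * e i p f) = (\<Sum>i\<in>UNIV. (eta i i * g p v (e i p)) * e i p f)" for f
      using frame_expansion[OF v] by metis
    from frame_coefficients_unique[OF this] show "x = (\<chi> i. eta i i * g p v (e i p))"
      by (simp add: vec_eq_iff)
  qed
qed simp

text \<open>
  Evaluating a trace through \<open>trace_at\<close> requires that all admissible frames \<open>E\<close> agree. If \<open>P\<close> expresses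
  \<open>E\<close> in \<open>e\<close> at \<open>p\<close>, tensoriality turns the two matrices \<open>m\<close> and \<open>C\<close> of \<open>T\<close> into conjugates: \<open>m P = P C\<close>.
\<close>
lemma trace_at_frame:
  assumes T: "\<And>f. tensorial (\<lambda>X p. T X p f)"
    and Te: "\<And>j f. T (e j) p f = (\<Sum>i\<in>UNIV. m i j * e i p f)"
  shows "trace_at A T p = (\<Sum>i\<in>UNIV. m i i)"
  unfolding trace_at_def
proof (rule the_equality)
  define M :: "real^3^3" where "M = (\<chi> i j. m i j)"
  show "\<exists>E. \<exists>c::real^3^3. (\<forall>i. E i \<in> vector_fields A) \<and> tangent_basis A p (\<lambda>i. E i p) \<and>
     (\<forall>j. T (E j) p = (\<lambda>f. \<Sum>i\<in>UNIV. c$i$j * E i p f)) \<and> (\<Sum>i\<in>UNIV. m i i) = trace c"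
    by (intro exI[of _ e] exI[of _ M]) (auto simp: frame_tangent_basis M_def Te trace_def fun_eq_iff)
  fix t
  assume "\<exists>E. \<exists>c::real^3^3. (\<forall>i. E i \<in> vector_fields A) \<and> tangent_basis A p (\<lambda>i. E i p) \<and>
     (\<forall>j. T (E j) p = (\<lambda>f. \<Sum>i\<in>UNIV. c$i$j * E i p f)) \<and> t = trace c"
  then obtain E and C :: "real^3^3" where E [simp]: "\<And>i. E i \<in> vector_fields A"
    and basis: "tangent_basis A p (\<lambda>i. E i p)"
    and TE: "\<And>j f. T (E j) p f = (\<Sum>i\<in>UNIV. C$i$j * E i p f)" and t: "t = trace C"
    by (auto simp: fun_eq_iff)
  define P :: "real^3^3" where "P = (\<chi> i j. coord (E j) i p)"
  have Ee: "E j p f = (\<Sum>i\<in>UNIV. P$i$j * e i p f)" for j f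
    using frame_comb_coord[OF E, of j] by (simp add: P_def frame_comb_def fun_eq_iff)
  have "\<forall>k. \<exists>q::real^3. e k p = (\<lambda>f. \<Sum>i\<in>UNIV. q$i * E i p f)"
    using basis vector_field_tangent[OF frame_field] unfolding tangent_basis_def by blast
  then obtain q :: "3 \<Rightarrow> real^3" where q: "\<And>k. e k p = (\<lambda>f. \<Sum>i\<in>UNIV. q k $ i * E i p f)"
    by metis
  define Q :: "real^3^3" where "Q = (\<chi> i k. q k $ i)"
  have "(\<Sum>l\<in>UNIV. (if l = k then 1 else 0) * e l p f) = (\<Sum>l\<in>UNIV. (P ** Q)$l$k * e l p f)" for k f
  proof -
    have "(\<Sum>l\<in>UNIV. (if l = k then 1 else 0) * e l p f) = (\<Sum>l\<in>UNIV. if k = l then e l p f else 0)"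
      by (rule sum.cong) auto
    also have "\<dots> = e k p f" by simp
    also have "\<dots> = (\<Sum>i\<in>UNIV. q k $ i * E i p f)"
      using q[of k] by meson
    also have "\<dots> = (\<Sum>l\<in>UNIV. (P ** Q)$l$k * e l p f)"
      by (simp add: Ee Q_def matrix_matrix_mult_def sum_3 algebra_simps)
    finally show ?thesis .
  qed
  from frame_coefficients_unique[OF this] have PQ: "P ** Q = mat 1"
    by (simp add: vec_eq_iff mat_def)
  then have QP: "Q ** P = mat 1"
    using matrix_left_right_inverse by blast
  have "(\<Sum>l\<in>UNIV. (M ** P)$l$j * e l p f) = (\<Sum>l\<in>UNIV. (P ** C)$l$j * e l p f)" for j f
  proof -
    have "(\<Sum>l\<in>UNIV. (M ** P)$l$j * e l p f) = (\<Sum>k\<in>UNIV. coord (E j) k p * T (e k) p f)"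
      by (simp add: M_def P_def Te matrix_matrix_mult_def sum_3 algebra_simps)
    also have "\<dots> = T (E j) p f"
      by (rule tensor_expand[OF T E, symmetric])
    also have "\<dots> = (\<Sum>l\<in>UNIV. (P ** C)$l$j * e l p f)"
      by (simp add: TE Ee matrix_matrix_mult_def sum_3 algebra_simps)
    finally show ?thesis .
  qed
  from frame_coefficients_unique[OF this] have "M ** P = P ** C"
    by (simp add: vec_eq_iff)
  then have "C = Q ** (M ** P)"
    using QP by (simp add: matrix_mul_assoc)
  then have "trace C = trace M"
    using PQ trace_mul_sym[of Q "M ** P"] by (simp flip: matrix_mul_assoc)
  then show "t = (\<Sum>i\<in>UNIV. m i i)"
    by (simp add: t M_def trace_def)
qed

lemma ricci_frame:
  assumes "X \<in> vector_fields A" "Y \<in> vector_fields A"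
  shows "ricci A D X Y = bilinear_form (ricci_coeff c) X Y"
proof
  fix p
  have "ricci A D X Y p = (\<Sum>i\<in>UNIV. bilinear_form (\<lambda>a b. curvature_coeff c a i b i) X Y p)"
    unfolding ricci_def
    by (rule trace_at_frame) (use assms in \<open>auto intro: tensorial_curvature2 simp: curvature_expand\<close>)
  then show "ricci A D X Y p = bilinear_form (ricci_coeff c) X Y p"
    by (simp add: bilinear_form_def ricci_coeff_def sum_3 algebra_simps)
qed

lemma bilinear_form_eta: "bilinear_form eta X Y p = (\<Sum>i\<in>UNIV. coord X i p * coord Y i p * eta i i)"
  by (simp add: bilinear_form_def)

lemma bilinear_form_frame_right: "bilinear_form b X (e j) p = (\<Sum>i\<in>UNIV. coord X i p * b i j)"
proof -
  have "(\<Sum>k\<in>UNIV. coord X i p * coord (e j) k p * b i k) = coord X i p * b i j" for i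
  proof -
    have "(\<Sum>k\<in>UNIV. coord X i p * coord (e j) k p * b i k) = (\<Sum>k\<in>UNIV. if j = k then coord X i p * b i k else 0)"
      by (rule sum.cong) auto
    then show ?thesis by simp
  qed
  then show ?thesis by (simp add: bilinear_form_def)
qed

lemma bilinear_form_frame_left: "bilinear_form b (e i) Y p = (\<Sum>j\<in>UNIV. coord Y j p * b i j)"
proof -
  have "(\<Sum>j\<in>UNIV. coord (e i) k p * coord Y j p * b k j) = (if i = k then (\<Sum>j\<in>UNIV. coord Y j p * b i j) else 0)" for k
    by auto
  then show ?thesis by (simp add: bilinear_form_def)
qed

text \<open>
  Raising an index multiplies by \<open>eta j j\<close>. Uniqueness holds because the products with the frame
  fields determine all coordinates.
\<close>
lemma ricci_operator_frame:
  assumes "X \<in> vector_fields A"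
  shows "ricci_operator A g D X = frame_comb (\<lambda>j p. \<Sum>a\<in>UNIV. coord X a p * (ricci_coeff c a j * eta j j))"
    (is "_ = ?W")
  unfolding ricci_operator_def
proof (rule the_equality)
  have W: "?W \<in> vector_fields A"
    using assms by (intro frame_comb_closed smooth_sum smooth_mult smooth_const) auto
  moreover have "g p (?W p) (Y p) = ricci A D X Y p" if "Y \<in> vector_fields A" for Y p
    using assms that W
    by (simp add: metric_bilinear_form ricci_frame bilinear_form_eta)
      (simp add: bilinear_form_def sum_3 algebra_simps)
  ultimately show "?W \<in> vector_fields A \<and> (\<forall>Y\<in>vector_fields A. \<forall>p. g p (?W p) (Y p) = ricci A D X Y p)"
    by blast
  fix V assume V: "V \<in> vector_fields A \<and> (\<forall>Y\<in>vector_fields A. \<forall>p. g p (V p) (Y p) = ricci A D X Y p)"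
  then have "coord V = (\<lambda>j p. \<Sum>a\<in>UNIV. coord X a p * (ricci_coeff c a j * eta j j))"
    using assms
    by (intro ext) (simp add: coord_def[of V] ricci_frame bilinear_form_frame_right sum_distrib_left mult_ac)
  then show "V = ?W"
    using V frame_comb_coord[of V] by metis
qed

lemma scalar_curvature_frame: "scalar_curvature A g D p = scalar_coeff c"
proof -
  have "scalar_curvature A g D p = (\<Sum>i\<in>UNIV. ricci_coeff c i i * eta i i)"
    unfolding scalar_curvature_def
  proof (rule trace_at_frame[where m = "\<lambda>i j. ricci_coeff c j i * eta i i"])
    show "tensorial (\<lambda>X p. ricci_operator A g D X p f)" for f
      by (rule tensorialI) (auto simp: ricci_operator_frame frame_comb_def sum_3 algebra_simps)
    fix j f
    have "(\<Sum>a\<in>UNIV. coord (e j) a p * (ricci_coeff c a i * eta i i)) = ricci_coeff c j i * eta i i" for i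
    proof -
      have "(\<Sum>a\<in>UNIV. coord (e j) a p * (ricci_coeff c a i * eta i i))
          = (\<Sum>a\<in>UNIV. if j = a then ricci_coeff c a i * eta i i else 0)"
        by (rule sum.cong) auto
      then show ?thesis by simp
    qed
    then show "ricci_operator A g D (e j) p f = (\<Sum>i\<in>UNIV. ricci_coeff c j i * eta i i * e i p f)"
      by (simp add: ricci_operator_frame frame_comb_def)
  qed
  then show ?thesis by (simp add: scalar_coeff_def)
qed

lemma schouten_frame:
  assumes "X \<in> vector_fields A" "Y \<in> vector_fields A"
  shows "schouten A g D X Y = bilinear_form (schouten_coeff c) X Y"
  using assms
  by (intro ext)
    (simp add: schouten_def scalar_curvature_frame ricci_frame metric_bilinear_form
      bilinear_form_def schouten_coeff_def[abs_def] sum_3 algebra_simps del: sum_delta_eta)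

text \<open>The first term of the covariant derivative drops out: the components are constant.\<close>
lemma schouten_deriv_frame:
  "cov_deriv02 D (schouten A g D) (e n) (e m) (e i) p = schouten_deriv_coeff c n m i"
proof -
  have "coord (D (e n) (e m)) l p = connection_coeff c n m l" for m l
    by (simp add: connection_frame)
  then have "bilinear_form (schouten_coeff c) (D (e n) (e m)) (e i) p
      = (\<Sum>l\<in>UNIV. connection_coeff c n m l * schouten_coeff c l i)"
    and "bilinear_form (schouten_coeff c) (e m) (D (e n) (e i)) p
      = (\<Sum>l\<in>UNIV. connection_coeff c n i l * schouten_coeff c m l)"
    by (simp_all add: bilinear_form_frame_right bilinear_form_frame_left)
  moreover have "e n p (bilinear_form (schouten_coeff c) (e m) (e i)) = 0"
  proof -
    have "bilinear_form (schouten_coeff c) (e m) (e i) = (\<lambda>p. schouten_coeff c m i)"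
      by (rule ext) simp
    then show ?thesis using tangent_const[OF vector_field_tangent[OF frame_field]] by simp
  qed
  ultimately show ?thesis
    by (simp add: cov_deriv02_def schouten_frame schouten_deriv_coeff_def)
qed

lemma tensorial_schouten_deriv:
  assumes [simp]: "X \<in> vector_fields A" "Z \<in> vector_fields A"
  shows "tensorial (cov_deriv02 D (schouten A g D) Z X)"
proof -
  define S where "S = bilinear_form (schouten_coeff c)"
  have T [simp]: "S X (vadd Y W) = (\<lambda>p. S X Y p + S X W p)"
    "h \<in> smooth_functions A \<Longrightarrow> S X (vscale h Y) = (\<lambda>p. h p * S X Y p)"
    if "X \<in> vector_fields A" "Y \<in> vector_fields A" "W \<in> vector_fields A" for X Y W h
    using tensorial_bilinear_form(2)[of "schouten_coeff c" X] that
    by (auto simp: S_def tensorial_def)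
  have smooth [simp]: "S X Y \<in> smooth_functions A" if "Y \<in> vector_fields A" for Y
    using that by (simp add: S_def)
  have deriv: "cov_deriv02 D (schouten A g D) Z X Y p = Z p (S X Y) - S (D Z X) Y p - S X (D Z Y) p"
    if "Y \<in> vector_fields A" for Y p
    using that by (simp add: cov_deriv02_def schouten_frame S_def)
  have Zp: "Z p \<in> tangent_space A p" for p by simp
  show ?thesis
    by (rule tensorialI)
      (simp_all add: deriv D_rules tangent_add[OF Zp] tangent_mult[OF Zp] algebra_simps)
qed

lemma cotton03_frame:
  assumes "X \<in> vector_fields A"
  shows "cotton03 A g D (e n) (e m) X p = (\<Sum>i\<in>UNIV. coord X i p * cotton03_coeff c n m i)"
  unfolding cotton03_def
  using tensor_expand[OF tensorial_schouten_deriv assms, of "e m" "e n" p]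
    tensor_expand[OF tensorial_schouten_deriv assms, of "e n" "e m" p]
  by (simp add: schouten_deriv_frame cotton03_coeff_def right_diff_distrib sum_subtractf)

lemma det_eta: "det (\<chi> i j. eta i j) = -1"
  by (simp add: det_3 eta_def)

lemma cotton02_frame:
  assumes "X \<in> vector_fields A" "Y \<in> vector_fields A"
  shows "cotton02 A g D e X Y p = bilinear_form (cotton02_coeff c) X Y p"
proof -
  have "g p (e l p) (Y p) = (\<Sum>j\<in>UNIV. coord Y j p * eta l j)" for l
    using metric_bilinear_form[OF frame_field assms(2)] by (simp only: bilinear_form_frame_left)
  then show ?thesis
    using assms
    by (simp add: cotton02_def det_eta cotton03_frame bilinear_form_def cotton02_coeff_def
        sum_3 levi_civita_symbol_def algebra_simps)
qed

text \<open>
  This form shows that the Lie derivative is tensorial in \<open>Y\<close> and \<open>Z\<close>, which its definition by brackets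
  hides.
\<close>
lemma lie_derivative_metric_eq:
  assumes "X \<in> vector_fields A" "Y \<in> vector_fields A" "Z \<in> vector_fields A"
  shows "lie_derivative_metric g X Y Z p = g p (D Y X p) (Z p) + g p (Y p) (D Z X p)"
proof -
  have 1: "g p (lie_bracket X Y p) (Z p) = g p (D X Y p) (Z p) - g p (D Y X p) (Z p)"
    using assms tensorial_metric_left[OF assms(3)] by (simp add: bracket_eq_D tensorial_def)
  have 2: "g p (Y p) (lie_bracket X Z p) = g p (Y p) (D X Z p) - g p (Y p) (D Z X p)"
    using assms tensorial_metric_right[OF assms(2)] by (simp add: bracket_eq_D tensorial_def)
  show ?thesis
    unfolding lie_derivative_metric_def 1 2 D_metric[OF assms] by simp
qed

lemma lie_derivative_metric_frame:
  fixes x :: "3 \<Rightarrow> real"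
  assumes "Y \<in> vector_fields A" "Z \<in> vector_fields A"
  defines "X \<equiv> frame_comb (\<lambda>i p. x i)"
  shows "lie_derivative_metric g X Y Z p = bilinear_form (lie_metric_coeff c x) Y Z p"
proof -
  have X [simp]: "X \<in> vector_fields A" by (simp add: X_def)
  have DX: "coord (D (e i) X) j p = (\<Sum>k\<in>UNIV. x k * connection_coeff c i k j)" for i j p
  proof -
    have "D (e i) X = frame_comb (\<lambda>j p. \<Sum>k\<in>UNIV. x k * connection_coeff c i k j)"
      unfolding X_def
      by (intro ext, unfold D_const_comb[OF frame_field])
        (simp add: connection_frame frame_comb_def sum_3 algebra_simps)
    then show ?thesis by simp
  qed
  have "g p (D Y X p) (Z p) + g p (Y p) (D Z X p) = bilinear_form (lie_metric_coeff c x) Y Z p"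
  proof (rule bilinear_formI[where T = "\<lambda>Y Z p. g p (D Y X p) (Z p) + g p (Y p) (D Z X p)"])
    fix i j p
    have "g p (D (e i) X p) (e j p) = coord (D (e i) X) j p * eta j j" for i j
      by (simp add: metric_bilinear_form bilinear_form_frame_right)
    moreover have "g p (e i p) (D (e j) X p) = coord (D (e j) X) i p * eta i i"
      by (simp add: metric_bilinear_form bilinear_form_frame_left)
    ultimately show "g p (D (e i) X p) (e j p) + g p (e i p) (D (e j) X p) = lie_metric_coeff c x i j"
      by (simp add: DX lie_metric_coeff_def sum_3 algebra_simps)
  qed (auto intro!: tensorialI assms
      simp: D_rules metric_vadd_vscale algebra_simps)
  then show ?thesis
    using assms by (simp add: lie_derivative_metric_eq)
qed

lemma bilinear_form_add: "bilinear_form a X Y p + bilinear_form b X Y p = bilinear_form (\<lambda>i j. a i j + b i j) X Y p"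
  by (simp add: bilinear_form_def distrib_left sum.distrib)

lemma bilinear_form_scale: "r * bilinear_form b X Y p = bilinear_form (\<lambda>i j. r * b i j) X Y p"
  by (simp add: bilinear_form_def sum_distrib_left mult_ac)

text \<open>
  The defining equation quantifies over all vector fields, but both sides are tensors, so the nine
  frame components suffice.
\<close>
lemma cotton_soliton_frame:
  "cotton_soliton A g D e (frame_comb (\<lambda>i p. x i)) lam \<longleftrightarrow>
     (\<forall>i j. lie_metric_coeff c x i j + cotton02_coeff c i j = lam * eta i j)"
proof -
  have "cotton_soliton A g D e (frame_comb (\<lambda>i p. x i)) lam \<longleftrightarrow>
     (\<forall>Y\<in>vector_fields A. \<forall>Z\<in>vector_fields A. \<forall>p.
        bilinear_form (\<lambda>i j. lie_metric_coeff c x i j + cotton02_coeff c i j) Y Z p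
        = bilinear_form (\<lambda>i j. lam * eta i j) Y Z p)"
    by (simp add: cotton_soliton_def lie_derivative_metric_frame cotton02_frame metric_bilinear_form
        bilinear_form_add bilinear_form_scale cong: ball_cong)
  also have "\<dots> \<longleftrightarrow> (\<forall>i j. lie_metric_coeff c x i j + cotton02_coeff c i j = lam * eta i j)"
  proof (intro iffI allI)
    fix i j
    assume *: "\<forall>Y\<in>vector_fields A. \<forall>Z\<in>vector_fields A. \<forall>p.
        bilinear_form (\<lambda>i j. lie_metric_coeff c x i j + cotton02_coeff c i j) Y Z p
        = bilinear_form (\<lambda>i j. lam * eta i j) Y Z p"
    show "lie_metric_coeff c x i j + cotton02_coeff c i j = lam * eta i j"
      using *[rule_format, of "e i" "e j"] by simp
  qed auto
  finally show ?thesis .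
qed

lemma cotton_vanishes_frame: "cotton_vanishes A g D e \<longleftrightarrow> (\<forall>i j. cotton02_coeff c i j = 0)"
proof
  assume "cotton_vanishes A g D e"
  then have "cotton02 A g D e (e i) (e j) p = 0" for i j p
    by (simp add: cotton_vanishes_def)
  then show "\<forall>i j. cotton02_coeff c i j = 0"
    by (simp add: cotton02_frame)
qed (auto simp: cotton_vanishes_def cotton02_frame bilinear_form_def)

end

section \<open>Geometry of the type III family\<close>

text \<open>
  The value of interest is \<open>s = 1 / sqrt 2\<close>. All components are polynomials in \<open>s\<close> and \<open>\<alpha>\<close>, so a
  parameter avoids computing with roots.
\<close>

definition type_III_bracket :: "real \<Rightarrow> real \<Rightarrow> 3 \<Rightarrow> 3 \<Rightarrow> 3 \<Rightarrow> real" where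
  "type_III_bracket s \<alpha> i j k =
     (if (i, j) = (1, 2) then vector [-s, 0, -\<alpha>]
      else if (i, j) = (2, 1) then vector [s, 0, \<alpha>]
      else if (i, j) = (1, 3) then vector [-s, -\<alpha>, 0]
      else if (i, j) = (3, 1) then vector [s, \<alpha>, 0]
      else if (i, j) = (2, 3) then vector [\<alpha>, s, -s]
      else if (i, j) = (3, 2) then vector [-\<alpha>, -s, s]
      else 0 :: real^3) $ k"

lemma type_III_brackets:
  assumes 12: "\<And>p f. lie_bracket (e 1) (e 2) p f = - s * e 1 p f - \<alpha> * e 3 p f"
    and 13: "\<And>p f. lie_bracket (e 1) (e 3) p f = - s * e 1 p f - \<alpha> * e 2 p f"
    and 23: "\<And>p f. lie_bracket (e 2) (e 3) p f = \<alpha> * e 1 p f + s * (e 2 p f - e 3 p f)"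
  shows "lie_bracket (e i) (e j) p f = (\<Sum>k\<in>UNIV. type_III_bracket s \<alpha> i j k * e k p f)"
proof -
  have lower: "lie_bracket (e 2) (e 1) p f = - (- s * e 1 p f - \<alpha> * e 3 p f)"
    "lie_bracket (e 3) (e 1) p f = - (- s * e 1 p f - \<alpha> * e 2 p f)"
    "lie_bracket (e 3) (e 2) p f = - (\<alpha> * e 1 p f + s * (e 2 p f - e 3 p f))"
    and diagonal: "lie_bracket X X p f = 0" for X
    unfolding 12[symmetric] 13[symmetric] 23[symmetric] by (simp_all add: lie_bracket_def)
  show ?thesis
    using exhaust_3[of i] exhaust_3[of j]
    by (elim disjE; hypsubst)
      (simp_all add: 12 13 23 lower diagonal type_III_bracket_def sum_3 right_diff_distrib)
qed

lemma type_III_connection: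
  "connection_coeff (type_III_bracket s \<alpha>) 1 1 k = vector [0, s, -s] $ k"
  "connection_coeff (type_III_bracket s \<alpha>) 1 2 k = vector [-s, 0, -\<alpha>/2] $ k"
  "connection_coeff (type_III_bracket s \<alpha>) 1 3 k = vector [-s, -\<alpha>/2, 0] $ k"
  "connection_coeff (type_III_bracket s \<alpha>) 2 1 k = vector [0, 0, \<alpha>/2] $ k"
  "connection_coeff (type_III_bracket s \<alpha>) 2 2 k = vector [0, 0, s] $ k"
  "connection_coeff (type_III_bracket s \<alpha>) 2 3 k = vector [\<alpha>/2, s, 0] $ k"
  "connection_coeff (type_III_bracket s \<alpha>) 3 1 k = vector [0, \<alpha>/2, 0] $ k"
  "connection_coeff (type_III_bracket s \<alpha>) 3 2 k = vector [-\<alpha>/2, 0, s] $ k"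
  "connection_coeff (type_III_bracket s \<alpha>) 3 3 k = vector [0, s, 0] $ k"
  using exhaust_3[of k] by (auto simp: connection_coeff_def type_III_bracket_def eta_def)

lemma type_III_ricci:
  "ricci_coeff (type_III_bracket s \<alpha>) 1 k = vector [-\<alpha>\<^sup>2/2, -s * \<alpha>, -s * \<alpha>] $ k"
  "ricci_coeff (type_III_bracket s \<alpha>) 2 k = vector [-s * \<alpha>, -\<alpha>\<^sup>2/2 - 2 * s\<^sup>2, -2 * s\<^sup>2] $ k"
  "ricci_coeff (type_III_bracket s \<alpha>) 3 k = vector [-s * \<alpha>, -2 * s\<^sup>2, \<alpha>\<^sup>2/2 - 2 * s\<^sup>2] $ k"
  using exhaust_3[of k]
  by (auto simp: ricci_coeff_def curvature_coeff_def sum_3 type_III_connection type_III_bracket_def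
      power2_eq_square algebra_simps)

lemma type_III_schouten:
  "schouten_coeff (type_III_bracket s \<alpha>) 1 k = vector [-\<alpha>\<^sup>2/8, -s * \<alpha>, -s * \<alpha>] $ k"
  "schouten_coeff (type_III_bracket s \<alpha>) 2 k = vector [-s * \<alpha>, -\<alpha>\<^sup>2/8 - 2 * s\<^sup>2, -2 * s\<^sup>2] $ k"
  "schouten_coeff (type_III_bracket s \<alpha>) 3 k = vector [-s * \<alpha>, -2 * s\<^sup>2, \<alpha>\<^sup>2/8 - 2 * s\<^sup>2] $ k"
  using exhaust_3[of k]
  by (auto simp: schouten_coeff_def scalar_coeff_def sum_3 type_III_ricci eta_def)

lemma type_III_cotton:
  "cotton02_coeff (type_III_bracket s \<alpha>) 1 k = vector [0, 3 * s * \<alpha>\<^sup>2/2, 3 * s * \<alpha>\<^sup>2/2] $ k"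
  "cotton02_coeff (type_III_bracket s \<alpha>) 2 k = vector [3 * s * \<alpha>\<^sup>2/2, 6 * s\<^sup>2*\<alpha>, 6 * s\<^sup>2*\<alpha>] $ k"
  "cotton02_coeff (type_III_bracket s \<alpha>) 3 k = vector [3 * s * \<alpha>\<^sup>2/2, 6 * s\<^sup>2*\<alpha>, 6 * s\<^sup>2*\<alpha>] $ k"
  using exhaust_3[of k]
  by (auto simp: cotton02_coeff_def cotton03_coeff_def schouten_deriv_coeff_def levi_civita_symbol_def
      sum_3 type_III_connection type_III_schouten eta_def power2_eq_square field_simps)

lemma type_III_lie_metric:
  "lie_metric_coeff (type_III_bracket s \<alpha>) x 1 k = vector [-2 * s*(x 2 + x 3), s * x 1, s * x 1] $ k"
  "lie_metric_coeff (type_III_bracket s \<alpha>) x 2 k = vector [s * x 1, 2 * s*x 3, s*(x 3 - x 2)] $ k"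
  "lie_metric_coeff (type_III_bracket s \<alpha>) x 3 k = vector [s * x 1, s*(x 3 - x 2), -2 * s*x 2] $ k"
  using exhaust_3[of k]
  by (auto simp: lie_metric_coeff_def sum_3 type_III_connection eta_def algebra_simps)

text \<open>
  The components \<open>(2,2)\<close> and \<open>(3,3)\<close> together say \<open>s (x\<^sub>2 + x\<^sub>3) = \<lambda>\<close>, while \<open>(1,1)\<close> says
  \<open>-2 s (x\<^sub>2 + x\<^sub>3) = \<lambda>\<close>. Thus only steady solitons occur, and the linear system is then regular.
\<close>
lemma type_III_soliton_equations:
  assumes "s \<noteq> 0"
  shows "(\<forall>i j. lie_metric_coeff (type_III_bracket s \<alpha>) x i j + cotton02_coeff (type_III_bracket s \<alpha>) i j
            = lam * eta i j)
    \<longleftrightarrow> lam = 0 \<and> x 1 = - 3 * \<alpha>\<^sup>2 / 2 \<and> x 2 = 3 * s * \<alpha> \<and> x 3 = - (3 * s * \<alpha>)"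
    (is "?L \<longleftrightarrow> ?R")
proof
  assume ?L
  then have eqs: "s * (-2 * x 2 - 2 * x 3) = lam" "s * (x 1 + 3 * \<alpha>\<^sup>2 / 2) = 0"
    "s * (2 * x 3 + 6 * s * \<alpha>) = lam" "s * (-2 * x 2 + 6 * s * \<alpha>) = - lam"
    unfolding forall_3
    by (simp_all add: type_III_lie_metric type_III_cotton eta_def power2_eq_square algebra_simps)
  then have "lam = 0"
    by (simp add: algebra_simps)
  with eqs assms have "x 1 + 3 * \<alpha>\<^sup>2 / 2 = 0" "-2 * x 2 - 2 * x 3 = 0" "2 * x 3 + 6 * s * \<alpha> = 0"
    by (metis mult_eq_0_iff)+
  moreover have "b = 3 * t \<and> d = - (3 * t)" if "-2 * b - 2 * d = 0" "2 * d + 6 * t = 0" for b d t :: real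
    using that by (intro conjI; linarith)
  moreover have "a = - 3 * u / 2" if "a + 3 * u / 2 = 0" for a u :: real
    using that by linarith
  ultimately show ?R
    using \<open>lam = 0\<close> unfolding mult.assoc by blast
next
  assume ?R
  then show ?L
    unfolding forall_3
    by (auto simp: type_III_lie_metric type_III_cotton eta_def power2_eq_square algebra_simps)
qed

lemma type_III_cotton_zero:
  assumes "s \<noteq> 0"
  shows "(\<forall>i j. cotton02_coeff (type_III_bracket s \<alpha>) i j = 0) \<longleftrightarrow> \<alpha> = 0"
  using assms unfolding forall_3 by (auto simp: type_III_cotton)

section \<open>The type III Lie algebra as a matrix algebra\<close>

definition commutator :: "real^'n^'n \<Rightarrow> real^'n^'n \<Rightarrow> real^'n^'n" where
  "commutator M N = M ** N - N ** M"

lemma commutator_linear: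
  fixes M N :: "real^'n^'n"
  shows
  "commutator (M + M') N = commutator M N + commutator M' N"
  "commutator M (N + N') = commutator M N + commutator M N'"
  "commutator (r *\<^sub>R M) N = r *\<^sub>R commutator M N"
  "commutator M (r *\<^sub>R N) = r *\<^sub>R commutator M N"
  by (simp_all add: commutator_def matrix_matrix_mult_def vec_eq_iff sum.distrib sum_distrib_left
      algebra_simps)

lemma commutator_self: "commutator M M = 0"
  by (simp add: commutator_def)

lemma commutator_swap: "commutator M N = - commutator N M"
  by (simp add: commutator_def)

lemma commutator_sl2_combination:
  assumes HE: "commutator H E = 2 *\<^sub>R E" and HF: "commutator H F = (-2) *\<^sub>R F" and EF: "commutator E F = H"
  shows "commutator (x *\<^sub>R H + y *\<^sub>R E + z *\<^sub>R F) (x' *\<^sub>R H + y' *\<^sub>R E + z' *\<^sub>R F)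
    = (y * z' - z * y') *\<^sub>R H + (2 * (x * y' - y * x')) *\<^sub>R E + (2 * (z * x' - x * z')) *\<^sub>R F"
proof -
  have "commutator E H = (-2) *\<^sub>R E" "commutator F H = 2 *\<^sub>R F" "commutator F E = (-1) *\<^sub>R H"
    using HE HF EF commutator_swap[of E H] commutator_swap[of F H] commutator_swap[of F E] by simp_all
  then show ?thesis
    by (simp add: commutator_linear commutator_self HE HF EF algebra_simps)
qed

text \<open>
  Coordinates of the frame in an \<open>sl\<^sub>2\<close>-triple \<open>(H, E, F)\<close>. Since \<open>e\<^sub>1\<close> acts on \<open>e\<^sub>2 - e\<^sub>3\<close> by \<open>\<alpha>\<close>, set
  \<open>e\<^sub>1 = (\<alpha>/2) H\<close> and \<open>e\<^sub>2 - e\<^sub>3 = E\<close>. Writing \<open>e\<^sub>3 = a H + b E + d F\<close>, the bracket with \<open>e\<^sub>1\<close> gives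
  \<open>a = -s/2\<close> and \<open>b = -1/2\<close>, and the bracket with \<open>e\<^sub>2\<close> gives \<open>d = \<alpha>\<^sup>2/2\<close>.
\<close>
definition type_III_coords :: "real \<Rightarrow> real \<Rightarrow> 3 \<Rightarrow> real^3" where
  "type_III_coords s \<alpha> i =
     (if i = 1 then vector [\<alpha>/2, 0, 0]
      else if i = 2 then vector [-s/2, 1/2, \<alpha>\<^sup>2/2]
      else vector [-s/2, -1/2, \<alpha>\<^sup>2/2])"

lemma type_III_from_sl2_triple:
  fixes s \<alpha> :: real
  assumes triple: "commutator H E = 2 *\<^sub>R E" "commutator H F = (-2) *\<^sub>R F" "commutator E F = H"
  defines "M \<equiv> \<lambda>i. type_III_coords s \<alpha> i $ 1 *\<^sub>R H + type_III_coords s \<alpha> i $ 2 *\<^sub>R E + type_III_coords s \<alpha> i $ 3 *\<^sub>R F"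
  shows "commutator (M i) (M j) = (\<Sum>k\<in>UNIV. type_III_bracket s \<alpha> i j k *\<^sub>R M k)"
proof -
  define t where "t = (\<lambda>l. \<Sum>k\<in>UNIV. type_III_bracket s \<alpha> i j k * type_III_coords s \<alpha> k $ l)"
  have "(\<Sum>k\<in>UNIV. type_III_bracket s \<alpha> i j k *\<^sub>R M k) = t 1 *\<^sub>R H + t 2 *\<^sub>R E + t 3 *\<^sub>R F"
    by (simp add: M_def t_def scaleR_add_right sum.distrib scaleR_sum_left)
  moreover have "type_III_coords s \<alpha> i $ 2 * type_III_coords s \<alpha> j $ 3
        - type_III_coords s \<alpha> i $ 3 * type_III_coords s \<alpha> j $ 2 = t 1 \<and>
      2 * (type_III_coords s \<alpha> i $ 1 * type_III_coords s \<alpha> j $ 2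
        - type_III_coords s \<alpha> i $ 2 * type_III_coords s \<alpha> j $ 1) = t 2 \<and>
      2 * (type_III_coords s \<alpha> i $ 3 * type_III_coords s \<alpha> j $ 1
        - type_III_coords s \<alpha> i $ 1 * type_III_coords s \<alpha> j $ 3) = t 3"
    using exhaust_3[of i] exhaust_3[of j]
    by (elim disjE; hypsubst)
      (simp_all add: t_def type_III_coords_def type_III_bracket_def sum_3 field_simps power2_eq_square)
  ultimately show ?thesis
    unfolding M_def commutator_sl2_combination[OF triple] by simp
qed

text \<open>The determinant of the coordinate change is a nonzero multiple of \<open>\<alpha>\<^sup>3\<close>.\<close>
lemma type_III_coordinates:
  assumes "\<alpha> \<noteq> 0"
  shows "bij (\<lambda>x::real^3. \<chi> l. \<Sum>k\<in>UNIV. x$k * type_III_coords s \<alpha> k $ l)" (is "bij ?f")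
proof (rule bijI)
  have f: "?f x = vector [\<alpha>/2 * x$1 - s/2 * (x$2 + x$3), (x$2 - x$3) / 2, \<alpha>\<^sup>2/2 * (x$2 + x$3)]" for x
    unfolding vec_eq_iff forall_3 by (simp add: type_III_coords_def sum_3 algebra_simps diff_divide_distrib)
  show "inj ?f"
  proof (rule injI)
    fix x y assume "?f x = ?f y"
    then have eqs: "\<alpha> * x$1 - s * (x$2 + x$3) = \<alpha> * y$1 - s * (y$2 + y$3)" "x$2 - x$3 = y$2 - y$3"
      "\<alpha>\<^sup>2 * (x$2 + x$3) = \<alpha>\<^sup>2 * (y$2 + y$3)"
      unfolding f vec_eq_iff forall_3 by (simp_all add: field_simps)
    then have "x$2 + x$3 = y$2 + y$3"
      using assms by (metis mult_cancel_left power_not_zero)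
    then show "x = y"
      using eqs assms by (simp add: vec_eq_iff forall_3)
  qed
  show "surj ?f"
  proof (rule surjI)
    fix y :: "real^3"
    show "?f (vector [2/\<alpha> * (y$1 + s * y$3/\<alpha>\<^sup>2), y$3/\<alpha>\<^sup>2 + y$2, y$3/\<alpha>\<^sup>2 - y$2]) = y"
      unfolding f using assms by (simp add: vec_eq_iff forall_3 field_simps)
  qed
qed

text \<open>A standard triple that is also a basis of \<open>L\<close>.\<close>
definition sl2_triple :: "(real^'n^'n) set \<Rightarrow> real^'n^'n \<Rightarrow> real^'n^'n \<Rightarrow> real^'n^'n \<Rightarrow> bool" where
  "sl2_triple L H E F \<longleftrightarrow> commutator H E = 2 *\<^sub>R E \<and> commutator H F = (-2) *\<^sub>R F \<and> commutator E F = H \<and>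
     L = {x *\<^sub>R H + y *\<^sub>R E + z *\<^sub>R F | x y z. True} \<and>
     (\<forall>x y z. x *\<^sub>R H + y *\<^sub>R E + z *\<^sub>R F = 0 \<longrightarrow> x = 0 \<and> y = 0 \<and> z = 0)"

lemma sl2_triple_sl2:
  "sl2_triple sl2 (vector [vector [1, 0], vector [0, -1]])
     (vector [vector [0, 1], vector [0, 0]]) (vector [vector [0, 0], vector [1, 0]])"
  (is "sl2_triple _ ?H ?E ?F")
proof -
  have "M = M$1$1 *\<^sub>R ?H + M$1$2 *\<^sub>R ?E + M$2$1 *\<^sub>R ?F" if "M \<in> sl2" for M
    using that by (simp add: sl2_def trace_def vec_eq_iff forall_2 sum_2)
  moreover have "x *\<^sub>R ?H + y *\<^sub>R ?E + z *\<^sub>R ?F \<in> sl2" for x y z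
    by (simp add: sl2_def trace_def sum_2)
  ultimately have "sl2 = {x *\<^sub>R ?H + y *\<^sub>R ?E + z *\<^sub>R ?F | x y z. True}"
    by blast
  then show ?thesis
    by (simp add: sl2_triple_def commutator_def matrix_matrix_mult_def vec_eq_iff forall_2 sum_2)
qed

text \<open>
  Let \<open>K\<^sub>2, K\<^sub>3\<close> be the boosts mixing the first axis with the second and the third, and \<open>R = [K\<^sub>2, K\<^sub>3]\<close> the
  rotation. Since \<open>K\<^sub>2\<close> exchanges \<open>K\<^sub>3\<close> and \<open>R\<close>, its eigenvectors are \<open>K\<^sub>3 + R\<close> and \<open>K\<^sub>3 - R\<close>, with
  eigenvalues \<open>1\<close> and \<open>-1\<close>; hence \<open>H = 2 K\<^sub>2\<close>, \<open>E = K\<^sub>3 + R\<close>, \<open>F = K\<^sub>3 - R\<close>.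
\<close>
lemma sl2_triple_so12:
  "sl2_triple so12 (vector [vector [0, 2, 0], vector [2, 0, 0], vector [0, 0, 0]])
     (vector [vector [0, 0, 1], vector [0, 0, 1], vector [1, -1, 0]])
     (vector [vector [0, 0, 1], vector [0, 0, -1], vector [1, 1, 0]])"
  (is "sl2_triple _ ?H ?E ?F")
proof -
  have "M = (M$1$2 / 2) *\<^sub>R ?H + ((M$1$3 + M$2$3) / 2) *\<^sub>R ?E + ((M$1$3 - M$2$3) / 2) *\<^sub>R ?F"
    if "M \<in> so12" for M
  proof -
    have "M$1$1 = 0 \<and> M$2$2 = 0 \<and> M$3$3 = 0 \<and> M$2$1 = M$1$2 \<and> M$3$1 = M$1$3 \<and> M$3$2 = - M$2$3"
      using that
      by (auto simp: so12_def Let_def transpose_def matrix_matrix_mult_def vec_eq_iff forall_3 sum_3)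
    then show ?thesis by (simp add: vec_eq_iff forall_3 field_simps)
  qed
  moreover have "x *\<^sub>R ?H + y *\<^sub>R ?E + z *\<^sub>R ?F \<in> so12" for x y z
    by (simp add: so12_def Let_def transpose_def matrix_matrix_mult_def vec_eq_iff forall_3 sum_3)
  ultimately have "so12 = {x *\<^sub>R ?H + y *\<^sub>R ?E + z *\<^sub>R ?F | x y z. True}"
    by blast
  moreover have "commutator ?H ?E = 2 *\<^sub>R ?E" "commutator ?H ?F = (-2) *\<^sub>R ?F" "commutator ?E ?F = ?H"
    unfolding commutator_def by (simp_all add: matrix_matrix_mult_def vec_eq_iff forall_3 sum_3)
  moreover have "x = 0 \<and> y = 0 \<and> z = 0" if "x *\<^sub>R ?H + y *\<^sub>R ?E + z *\<^sub>R ?F = 0" for x y z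
  proof -
    have "(x *\<^sub>R ?H + y *\<^sub>R ?E + z *\<^sub>R ?F) $ i $ j = 0" for i j
      using that by simp
    from this[of 1 2] this[of 1 3] this[of 2 3] show ?thesis by simp
  qed
  ultimately show ?thesis
    unfolding sl2_triple_def by blast
qed

context constant_frame
begin

lemma lie_bracket_const_comb:
  "lie_bracket (frame_comb (\<lambda>i p. x i)) (frame_comb (\<lambda>i p. y i))
     = frame_comb (\<lambda>k p. \<Sum>i\<in>UNIV. \<Sum>j\<in>UNIV. x i * y j * c i j k)"
proof (intro ext)
  fix p f
  have D: "D (frame_comb (\<lambda>i p. x i)) (frame_comb (\<lambda>i p. y i)) p f
      = (\<Sum>i\<in>UNIV. \<Sum>j\<in>UNIV. x i * y j * D (e i) (e j) p f)" for x y :: "3 \<Rightarrow> real"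
    unfolding D_const_comb[OF frame_comb_closed[OF smooth_const]]
      tensor_expand[OF tensorial_D[OF frame_field] frame_comb_closed[OF smooth_const]]
    by (simp add: sum_3 algebra_simps)
  have torsion: "D (e i) (e j) p f - D (e j) (e i) p f = (\<Sum>k\<in>UNIV. c i j k * e k p f)" for i j
    using bracket_eq_D[of "e i" "e j"] bracket_frame[of i j] by (simp add: fun_eq_iff)
  have "(\<Sum>i\<in>UNIV. \<Sum>j\<in>UNIV. x i * y j * (D (e i) (e j) p f - D (e j) (e i) p f))
      = frame_comb (\<lambda>k p. \<Sum>i\<in>UNIV. \<Sum>j\<in>UNIV. x i * y j * c i j k) p f"
    unfolding torsion by (simp add: frame_comb_def sum_3 algebra_simps)
  moreover have "lie_bracket (frame_comb (\<lambda>i p. x i)) (frame_comb (\<lambda>i p. y i)) p f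
      = (\<Sum>i\<in>UNIV. \<Sum>j\<in>UNIV. x i * y j * (D (e i) (e j) p f - D (e j) (e i) p f))"
    by (simp add: bracket_eq_D D sum_3 algebra_simps)
  ultimately show "lie_bracket (frame_comb (\<lambda>i p. x i)) (frame_comb (\<lambda>i p. y i)) p f
      = frame_comb (\<lambda>k p. \<Sum>i\<in>UNIV. \<Sum>j\<in>UNIV. x i * y j * c i j k) p f"
    by simp
qed

text \<open>The push-forward of tangent vectors is linear.\<close>
lemma const_comb_left_invariant:
  assumes "\<And>i. e i \<in> lie_algebra G A"
  shows "frame_comb (\<lambda>i p. x i) \<in> lie_algebra G A"
  unfolding lie_algebra_def mem_Collect_eq
proof (intro conjI allI)
  show "frame_comb (\<lambda>i p. x i) \<in> vector_fields A" by simp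
  fix a p
  have "e i (a \<otimes>\<^bsub>G\<^esub> p) = pushforward A (\<lambda>q. a \<otimes>\<^bsub>G\<^esub> q) (e i p)" for i
    using assms[of i] unfolding lie_algebra_def by blast
  then show "frame_comb (\<lambda>i p. x i) (a \<otimes>\<^bsub>G\<^esub> p)
      = pushforward A (\<lambda>q. a \<otimes>\<^bsub>G\<^esub> q) (frame_comb (\<lambda>i p. x i) p)"
    by (simp add: frame_comb_def pushforward_def fun_eq_iff)
qed

lemma matrix_lie_algebra_iso:
  fixes M :: "3 \<Rightarrow> real^'n^'n"
  assumes basis: "lie_algebra_basis G A e"
    and bracket: "\<And>i j. commutator (M i) (M j) = (\<Sum>k\<in>UNIV. c i j k *\<^sub>R M k)"
    and bij: "bij_betw (\<lambda>x::real^3. \<Sum>i\<in>UNIV. x$i *\<^sub>R M i) UNIV L"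
  shows "isomorphic_to_matrix_lie_algebra G A L"
proof -
  define comb where "comb x = frame_comb (\<lambda>i p. x $ i)" for x :: "real^3"
  \<comment> \<open>The coordinates of left-invariant fields are constant, so they may be read off at any one point.\<close>
  define \<Phi> where "\<Phi> X = (\<Sum>i\<in>UNIV. coord X i undefined *\<^sub>R M i)" for X
  have \<Phi>_comb: "\<Phi> (comb x) = (\<Sum>i\<in>UNIV. x$i *\<^sub>R M i)" for x
    by (simp add: \<Phi>_def comb_def)
  have obtain_comb: "\<exists>x. X = comb x" if "X \<in> lie_algebra G A" for X
    using basis that unfolding lie_algebra_basis_def comb_def frame_comb_def by blast
  have comb_in: "comb x \<in> lie_algebra G A" for x
    unfolding comb_def by (rule const_comb_left_invariant) (use basis in \<open>simp add: lie_algebra_basis_def\<close>)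
  have image: "lie_algebra G A = range comb"
    using obtain_comb comb_in by blast
  have "inj comb"
  proof (rule injI)
    fix x y assume "comb x = comb y"
    then have "coord (comb x) i undefined = coord (comb y) i undefined" for i by simp
    then show "x = y" by (simp add: comb_def vec_eq_iff)
  qed
  then have "bij_betw comb UNIV (lie_algebra G A)"
    by (simp add: bij_betw_def image)
  moreover have "bij_betw (\<Phi> \<circ> comb) UNIV L"
    using bij by (simp add: comp_def \<Phi>_comb)
  ultimately have "bij_betw \<Phi> (lie_algebra G A) L"
    using bij_betw_comp_iff by blast
  moreover have "\<Phi> (vadd (comb x) (comb y)) = \<Phi> (comb x) + \<Phi> (comb y)" for x y
    by (simp add: \<Phi>_def comb_def scaleR_add_left sum.distrib)
  moreover have "\<Phi> (vscale (\<lambda>p. r) (comb x)) = r *\<^sub>R \<Phi> (comb x)" for r x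
    by (simp add: \<Phi>_def comb_def scaleR_sum_right)
  moreover have "\<Phi> (lie_bracket (comb x) (comb y)) = commutator (\<Phi> (comb x)) (\<Phi> (comb y))" for x y
  proof -
    have "commutator (\<Phi> (comb x)) (\<Phi> (comb y)) = (\<Sum>i\<in>UNIV. \<Sum>j\<in>UNIV. (x$i * y$j) *\<^sub>R commutator (M i) (M j))"
      by (simp add: \<Phi>_comb sum_3 commutator_linear algebra_simps)
    then show ?thesis
      unfolding comb_def lie_bracket_const_comb bracket \<Phi>_def
      by (simp add: sum_3 algebra_simps)
  qed
  ultimately show ?thesis
    unfolding isomorphic_to_matrix_lie_algebra_def image commutator_def[symmetric]
    by (intro exI[of _ \<Phi>]) auto
qed

end

text \<open>
  The isomorphism is the composite of the coordinate change from the frame to the triple with the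
  parametrisation of \<open>L\<close> by the triple.
\<close>
lemma type_III_iso:
  fixes H E F :: "real^'n^'n"
  assumes frame: "constant_frame A g D e (type_III_bracket s \<alpha>)"
    and basis: "lie_algebra_basis G A e"
    and triple: "sl2_triple L H E F"
    and "\<alpha> \<noteq> 0"
  shows "isomorphic_to_matrix_lie_algebra G A L"
proof -
  interpret constant_frame A g D e "type_III_bracket s \<alpha>" by (rule frame)
  define N where "N y = y$1 *\<^sub>R H + y$2 *\<^sub>R E + y$3 *\<^sub>R F" for y :: "real^3"
  define f where "f x = (\<chi> l. \<Sum>k\<in>UNIV. x$k * type_III_coords s \<alpha> k $ l)" for x :: "real^3"
  have "bij_betw f UNIV UNIV"
    using type_III_coordinates[OF \<open>\<alpha> \<noteq> 0\<close>, of s] by (simp add: f_def[abs_def])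
  moreover have "bij_betw N UNIV L"
    unfolding bij_betw_def
  proof
    show "inj N"
    proof (rule injI)
      fix y z assume "N y = N z"
      then have "(y$1 - z$1) *\<^sub>R H + (y$2 - z$2) *\<^sub>R E + (y$3 - z$3) *\<^sub>R F = 0"
        by (simp add: N_def algebra_simps)
      then have "y$1 - z$1 = 0 \<and> y$2 - z$2 = 0 \<and> y$3 - z$3 = 0"
        using triple unfolding sl2_triple_def by blast
      then show "y = z" by (simp add: vec_eq_iff forall_3)
    qed
    show "range N = L"
    proof
      show "L \<subseteq> range N"
      proof
        fix m assume "m \<in> L"
        then obtain x y z where "m = x *\<^sub>R H + y *\<^sub>R E + z *\<^sub>R F"
          using triple unfolding sl2_triple_def by blast
        then have "m = N (vector [x, y, z])" by (simp add: N_def)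
        then show "m \<in> range N" by blast
      qed
      show "range N \<subseteq> L"
        using triple unfolding sl2_triple_def N_def by blast
    qed
  qed
  ultimately have bij: "bij_betw (N \<circ> f) UNIV L"
    by (rule bij_betw_trans)
  show ?thesis
  proof (rule matrix_lie_algebra_iso[OF basis])
    show "commutator (N (type_III_coords s \<alpha> i)) (N (type_III_coords s \<alpha> j))
      = (\<Sum>k\<in>UNIV. type_III_bracket s \<alpha> i j k *\<^sub>R N (type_III_coords s \<alpha> k))" for i j
      unfolding N_def using triple by (intro type_III_from_sl2_triple) (auto simp: sl2_triple_def)
    have "(\<Sum>i\<in>UNIV. x$i *\<^sub>R N (type_III_coords s \<alpha> i)) = (N \<circ> f) x" for x
      by (simp add: N_def f_def scaleR_add_right sum.distrib scaleR_sum_left)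
    then show "bij_betw (\<lambda>x. \<Sum>i\<in>UNIV. x$i *\<^sub>R N (type_III_coords s \<alpha> i)) UNIV L"
      using bij by (simp add: comp_def)
  qed
qed

section \<open>Left-invariant Cotton solitons\<close>

theorem theorem7:
  fixes G :: "'g::{t2_space, second_countable_topology} monoid"
    and A :: "'g atlas"
    and g :: "'g metric"
    and D :: "'g connection"
    and e :: "3 \<Rightarrow> 'g vfield"
    and \<alpha> :: real
  assumes "lie_group G A"
    and "connected (UNIV :: 'g set)"
    and "simply_connected (UNIV :: 'g set)"
    and "lorentzian_metric A g"
    and "left_invariant_metric G A g"
    and "levi_civita A g D"
    and "lie_algebra_basis G A e"
    and "\<And>p i j. g p (e i p) (e j p) = eta i j"
    and "lie_bracket (e 1) (e 2) = (\<lambda>p f. - (1 / sqrt 2) * e 1 p f - \<alpha> * e 3 p f)"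
    and "lie_bracket (e 1) (e 3) = (\<lambda>p f. - (1 / sqrt 2) * e 1 p f - \<alpha> * e 2 p f)"
    and "lie_bracket (e 2) (e 3) = (\<lambda>p f. \<alpha> * e 1 p f + 1 / sqrt 2 * (e 2 p f - e 3 p f))"
  shows "((\<exists>X\<in>lie_algebra G A. \<exists>lam. cotton_soliton A g D e X lam \<and> \<not> cotton_vanishes A g D e)
            \<longleftrightarrow> \<alpha> \<noteq> 0) \<and>
         (\<alpha> \<noteq> 0 \<longrightarrow>
            isomorphic_to_matrix_lie_algebra G A so12 \<and>
            isomorphic_to_matrix_lie_algebra G A sl2 \<and>
            (\<forall>X\<in>lie_algebra G A. \<forall>lam. cotton_soliton A g D e X lam \<longleftrightarrow>
               lam = 0 \<and>
               X = (\<lambda>p f. - (3 * \<alpha>\<^sup>2 / 2) * e 1 p f + 3 * \<alpha> / sqrt 2 * (e 2 p f - e 3 p f))))"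
proof -
  define s :: real where "s = 1 / sqrt 2"
  have "s \<noteq> 0" by (simp add: s_def)
  have e: "e i \<in> lie_algebra G A" for i
    using assms(7) by (simp add: lie_algebra_basis_def)
  have lorentzian: "lorentzian_manifold A g D"
  proof (rule lorentzian_manifold.intro)
    show "smooth_atlas A"
      using assms(1) unfolding lie_group_def by (rule conjunct1)
  qed (rule assms(4), rule assms(6))
  have brackets: "lie_bracket (e 1) (e 2) p f = - s * e 1 p f - \<alpha> * e 3 p f"
    "lie_bracket (e 1) (e 3) p f = - s * e 1 p f - \<alpha> * e 2 p f"
    "lie_bracket (e 2) (e 3) p f = \<alpha> * e 1 p f + s * (e 2 p f - e 3 p f)" for p f
    unfolding assms(9-11) s_def by (rule refl)+
  have frame: "constant_frame A g D e (type_III_bracket s \<alpha>)"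
  proof (intro constant_frame.intro constant_frame_axioms.intro lorentzian)
    show "e i \<in> vector_fields A" for i
      using e by (simp add: lie_algebra_def)
    show "g p (e i p) (e j p) = eta i j" for p i j
      by (rule assms(8))
    show "lie_bracket (e i) (e j) = (\<lambda>p f. \<Sum>k\<in>UNIV. type_III_bracket s \<alpha> i j k * e k p f)" for i j
      by (intro ext type_III_brackets brackets)
  qed
  interpret constant_frame A g D e "type_III_bracket s \<alpha>" by (rule frame)
  define v where "v i = (if i = 1 then - 3 * \<alpha>\<^sup>2 / 2 else if i = 2 then 3 * s * \<alpha> else - (3 * s * \<alpha>))"
    for i :: 3
  have v: "frame_comb (\<lambda>i p. v i)
      = (\<lambda>p f. - (3 * \<alpha>\<^sup>2 / 2) * e 1 p f + 3 * \<alpha> / sqrt 2 * (e 2 p f - e 3 p f))"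
    by (intro ext) (simp add: frame_comb_def sum_3 v_def s_def algebra_simps)
  have soliton: "cotton_soliton A g D e X lam \<longleftrightarrow> lam = 0 \<and> X = frame_comb (\<lambda>i p. v i)"
    if "X \<in> lie_algebra G A" for X lam
  proof -
    obtain x :: "real^3" where x: "X = frame_comb (\<lambda>i p. x $ i)"
      using assms(7) \<open>X \<in> lie_algebra G A\<close> unfolding lie_algebra_basis_def frame_comb_def by blast
    have "X = frame_comb (\<lambda>i p. v i) \<longleftrightarrow> (\<forall>i. x $ i = v i)"
    proof
      assume "X = frame_comb (\<lambda>i p. v i)"
      then have "coord X i undefined = v i" for i by simp
      then show "\<forall>i. x $ i = v i" by (simp add: x)
    qed (simp add: x)
    then show ?thesis
      unfolding x cotton_soliton_frame type_III_soliton_equations[OF \<open>s \<noteq> 0\<close>]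
      by (simp add: forall_3 v_def)
  qed
  have nonvanishing: "\<not> cotton_vanishes A g D e \<longleftrightarrow> \<alpha> \<noteq> 0"
    unfolding cotton_vanishes_frame type_III_cotton_zero[OF \<open>s \<noteq> 0\<close>] ..
  have "frame_comb (\<lambda>i p. v i) \<in> lie_algebra G A"
    by (rule const_comb_left_invariant[OF e])
  then show ?thesis
    using soliton nonvanishing type_III_iso[OF frame assms(7) sl2_triple_so12]
      type_III_iso[OF frame assms(7) sl2_triple_sl2]
    unfolding v by blast
qed

end
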